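(* Let $\{z^k=(\boldsymbol\alpha^{(k)},\boldsymbol m^{(k)})\}_{k\in\mathbb{N}}$ be the sequence generated by the IRSOM algorithm (defined in the context) with $\gamma,\beta>0$. Then the following statements hold. (i) The sequence $\{z^k\}_{k\in\mathbb{N}}$ is convergent. (ii) Let $n_j=M-L_\alpha$ be the dimension of the variable $\boldsymbol\alpha_j$, let $L\ge\max_{1\le j\le J}\sqrt{n_j}$ be a constant such that $\|\xi\|_1\le L\|\xi\|$ for any $\xi\in\mathbb{C}^{n_j}$, $j=1,\dots,J$, and let $\varepsilon=\max\{\gamma L,\beta\}$. Then the limit point $z^*$ of $\{z^k\}_{k\in\mathbb{N}}$ is an $\varepsilon$-stationary point of the objective function $F^{som}$, that is, $$\|\nabla F^{som}(z^* )\|_\infty\le\varepsilon.$$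
   Context: Notation. $\|\cdot\|$, $\|\cdot\|_1$, $\|\cdot\|_\infty$ denote the $\ell_2$-norm, the $\ell_1$-norm (sum of moduli) and the infinity norm (maximum modulus) of complex vectors; $(\boldsymbol\xi)_\ell$ is the $\ell$-th element of $\boldsymbol\xi$; $\langle a,b\rangle=b^*a=\sum_\ell a_\ell\overline{b_\ell}$; $\odot$ is the entrywise product. For a real-valued function $\psi$ on $\mathbb{C}^q$, writing $w=w_r+iw_i$ with $w_r,w_i\in\mathbb{R}^q$ and $\psi(w)=\widetilde\psi(w_r,w_i)$, the complex gradient is $\nabla_w\psi:=\nabla_{w_r}\widetilde\psi+i\nabla_{w_i}\widetilde\psi$; $\nabla F^{som}$ is the complex gradient with respect to all variables $(\boldsymbol\alpha_1,\dots,\boldsymbol\alpha_J,\boldsymbol m)$. For $\tau\ge0$, $S_\tau:\mathbb{C}\to\mathbb{C}$ is $S_\tau(a)=(|a|-\tau)\frac{a}{|a|}$ if $|a|>\tau$ and $S_\tau(a)=0$ if $|a|\le\tau$. Discrete scattering data. Let $n\in\{2,3\}$, wave number $\kappa>0$, mesh size $h>0$, $N\in\mathbb{N}$ positive, $M=N^n$, and let $p^1,\dots,p^M$ be an enumeration of $\{p\in\mathbb{Z}^n:-N/2<p_k\le N/2,\ k=1,\dots,n\}$. Let $\Phi(\kappa r)=\frac i4H_0^{(1)}(\kappa r)$ if $n=2$ (with $H_0^{(1)}$ the Hankel function of the first kind of order zero) and $\Phi(\kappa r)=\frac1{4\pi}\frac{e^{i\kappa r}}{\kappa r}$ if $n=3$;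 put $\Phi_{p,h}=\Phi(\kappa|p|h)$ for $p\ne0$ and $\Phi_{0,h}=0$. Let $T\in\mathbb{C}^{M\times M}$ have entries $T_{ab}=\kappa^nh^n\Phi_{p^a-p^b,h}$. Let $\hat x^1,\dots,\hat x^Q$ be distinct unit vectors of $\mathbb{R}^n$ (observation directions) and let $T^\infty\in\mathbb{C}^{Q\times M}$ have entries $T^\infty_{ab}=\theta_{n,\kappa}h^ne^{-i\kappa\hat x^a\cdot p^bh}$, with $\theta_{2,\kappa}=\kappa^{3/2}e^{i\pi/4}/\sqrt{8\pi}$, $\theta_{3,\kappa}=\kappa^2/(4\pi)$. For $j=1,\dots,J$ let $d_j$ be distinct unit vectors (incident directions), $\boldsymbol u^i_j=(e^{i\kappa p^1h\cdot d_j},\dots,e^{i\kappa p^Mh\cdot d_j})^\top\in\mathbb{C}^M$, and let $\boldsymbol u_j^{\infty,\delta}\in\mathbb{C}^Q$ be the given (noisy) measurement data. SVD splitting. Let $T^\infty=\sum_k\boldsymbol u_k\lambda_k\boldsymbol v_k^*$ be a singular value decomposition with right singular vectors $\boldsymbol v_1,\dots,\boldsymbol v_M$ forming an orthonormal basis of $\mathbb{C}^M$, left singular vectors $\boldsymbol u_k\in\mathbb{C}^Q$, and $\lambda_1\ge\dots\ge\lambda_{L_0}>\lambda_{L_0+1}=\dots=\lambda_M=0$. Fix an integer $L_\alpha\in[1,L_0]$ and put $\boldsymbol\omega_j^s=\sum_{k=1}^{L_\alpha}\frac{\langle\boldsymbol u_j^{\infty,\delta},\boldsymbol u_k\rangle}{\lambda_k}\boldsymbol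 v_k$ and $V^n=(\boldsymbol v_{L_\alpha+1},\dots,\boldsymbol v_M)\in\mathbb{C}^{M\times(M-L_\alpha)}$ (the superscripts $s$, $n$ in $\boldsymbol\omega_j^s$, $V^n$ are labels, not powers). Objective. For $\boldsymbol\alpha_j\in\mathbb{C}^{M-L_\alpha}$, $\boldsymbol m\in\mathbb{C}^M$ and positive constants $\eta_{s,j},\eta_{d,j}$, $$F_j^{som}(\boldsymbol\alpha_j,\boldsymbol m)=\eta_{s,j}\|\boldsymbol m\odot\boldsymbol u^i_j+\boldsymbol m\odot T(\boldsymbol\omega_j^s+V^n\boldsymbol\alpha_j)-(\boldsymbol\omega_j^s+V^n\boldsymbol\alpha_j)\|^2+\eta_{d,j}\|\boldsymbol u_j^{\infty,\delta}-T^\infty\boldsymbol\omega_j^s-T^\infty V^n\boldsymbol\alpha_j\|^2,$$ and $F^{som}(\boldsymbol\alpha,\boldsymbol m)=\sum_{j=1}^JF_j^{som}(\boldsymbol\alpha_j,\boldsymbol m)$ with $\boldsymbol\alpha=(\boldsymbol\alpha_1,\dots,\boldsymbol\alpha_J)$. IRSOM algorithm (run without termination). Start from $\boldsymbol\alpha_j^{(0)}=0$ ($j=1,\dots,J$) and a given initial vector $\boldsymbol m^{(0)}\in\mathbb{C}^M$. For $r=0,1,2,\dots$: 1. For all $j$ compute $g_j^{(r)}=\nabla_{\boldsymbol\alpha_j}F^{som}(\boldsymbol\alpha^{(r)},\boldsymbol m^{(r)})$ and the direction $\boldsymbol\rho_j^{(r)}$: $\boldsymbol\rho_j^{(0)}=g_j^{(0)}$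 and, for $r\ge1$, $\boldsymbol\rho_j^{(r)}=g_j^{(r)}+\frac{\mathrm{Re}\langle g_j^{(r)},g_j^{(r)}-g_j^{(r-1)}\rangle}{\|g_j^{(r-1)}\|^2}\boldsymbol\rho_j^{(r-1)}$ if $g_j^{(r-1)}\ne0$, $\boldsymbol\rho_j^{(r)}=g_j^{(r)}$ if $g_j^{(r-1)}=0$. 2. Set $\boldsymbol\alpha_j^{(r+1)}=\boldsymbol\alpha_j^{(r)}+s_j^{(r)}\boldsymbol\rho_j^{(r)}$, where, with $B=2\eta_{s,j}\|V^n\boldsymbol\rho_j^{(r)}-\boldsymbol m^{(r)}\odot TV^n\boldsymbol\rho_j^{(r)}\|^2+2\eta_{d,j}\|T^\infty V^n\boldsymbol\rho_j^{(r)}\|^2$, $s_j^{(r)}=0$ if $B=0$ and otherwise $s_j^{(r)}=S_\tau(z)$ with $\tau=\gamma\|\boldsymbol\rho_j^{(r)}\|_1/B$, $z=-\langle g_j^{(r)},\boldsymbol\rho_j^{(r)}\rangle/B$. (This $s_j^{(r)}$ is the chosen element of $\arg\min_{s\in\mathbb{C}}F_j^{som}(\boldsymbol\alpha_j^{(r)}+s\boldsymbol\rho_j^{(r)},\boldsymbol m^{(r)})+\gamma\|s\boldsymbol\rho_j^{(r)}\|_1$.) 3. With $\boldsymbol\omega_j^{(r+1)}=\boldsymbol\omega_j^s+V^n\boldsymbol\alpha_j^{(r+1)}$, $\boldsymbol u_j^{(r+1)}=\boldsymbol u^i_j+T\boldsymbol\omega_j^{(r+1)}$ and, for each $\ell$,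 $A_\ell=\sum_{j=1}^J\eta_{s,j}|(\boldsymbol u_j^{(r+1)})_\ell|^2$, set $(\boldsymbol m^{(r+1)})_\ell=(\boldsymbol m^{(r)})_\ell$ if $(\boldsymbol u_j^{(r+1)})_\ell=0$ for all $j$, and otherwise $(\boldsymbol m^{(r+1)})_\ell=(\boldsymbol m^{(r)})_\ell+S_\tau(z-(\boldsymbol m^{(r)})_\ell)$ with $\tau=\beta/(2A_\ell)$ and $z=A_\ell^{-1}\sum_{j=1}^J\eta_{s,j}\overline{(\boldsymbol u_j^{(r+1)})_\ell}(\boldsymbol\omega_j^{(r+1)})_\ell$. (This $\boldsymbol m^{(r+1)}$ is the chosen element of $\arg\min_{\boldsymbol m\in\mathbb{C}^M}F^{som}(\boldsymbol\alpha^{(r+1)},\boldsymbol m)+\beta\|\boldsymbol m-\boldsymbol m^{(r)}\|_1$.) *)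

theory Defs
  imports "HOL-Analysis.Analysis" "Jordan_Normal_Form.Matrix"
begin

unbundle no vec_syntax
unbundle no inner_syntax

text \<open>
  Vectors and matrices of parameter-dependent size are those of Jordan_Normal_Form, with indices
  starting at 0: the objects numbered \<open>1, \<dots>, K\<close> in the text are numbered \<open>0, \<dots>, K - 1\<close> here.
  The inner product \<open>\<langle>a, b\<rangle> = b\<^sup>* a\<close> is \<open>a \<bullet>c b\<close>.
\<close>

section \<open>Norms, entrywise product, soft thresholding\<close>

definition l2_norm :: "'a::real_normed_vector vec \<Rightarrow> real" where
  "l2_norm x = sqrt (\<Sum>i<dim_vec x. (norm (x $ i))\<^sup>2)"

definition l1_norm :: "'a::real_normed_vector vec \<Rightarrow> real" where
  "l1_norm x = (\<Sum>i<dim_vec x. norm (x $ i))"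

text \<open>The inserted 0 only matters for the vector of dimension 0.\<close>

definition linf_norm :: "'a::real_normed_vector vec \<Rightarrow> real" where
  "linf_norm x = Max (insert 0 ((\<lambda>i. norm (x $ i)) ` {..<dim_vec x}))"

definition hadamard :: "complex vec \<Rightarrow> complex vec \<Rightarrow> complex vec" (infixl "\<odot>" 70) where
  "x \<odot> y = vec (dim_vec x) (\<lambda>i. x $ i * y $ i)"

definition soft :: "real \<Rightarrow> complex \<Rightarrow> complex" where
  "soft \<tau> a = (if cmod a > \<tau> then of_real (cmod a - \<tau>) * (a / of_real (cmod a)) else 0)"

section \<open>Complex gradient\<close>

text \<open>Entry \<open>l\<close> is the partial derivative of \<open>\<psi>\<close> with respect to the real part of the \<open>l\<close>-th
  variable plus \<open>\<i>\<close> times the partial derivative with respect to its imaginary part.\<close>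

definition complex_grad :: "(complex vec \<Rightarrow> real) \<Rightarrow> complex vec \<Rightarrow> complex vec" where
  "complex_grad \<psi> w = vec (dim_vec w) (\<lambda>l.
     of_real (deriv (\<lambda>t::real. \<psi> (w + of_real t \<cdot>\<^sub>v unit_vec (dim_vec w) l)) 0) +
     \<i> * of_real (deriv (\<lambda>t::real. \<psi> (w + (\<i> * of_real t) \<cdot>\<^sub>v unit_vec (dim_vec w) l)) 0))"

section \<open>Discrete scattering data\<close>

text \<open>Bessel functions of order zero for positive real argument, by the classical ascending
  series; \<open>harm k = 1 + 1/2 + \<dots> + 1/k\<close>.\<close>

definition bessel_J0 :: "real \<Rightarrow> real" where
  "bessel_J0 x = (\<Sum>k. (-1) ^ k * (x\<^sup>2 / 4) ^ k / (fact k)\<^sup>2)"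

definition bessel_Y0 :: "real \<Rightarrow> real" where
  "bessel_Y0 x = 2 / pi * (ln (x / 2) + euler_mascheroni) * bessel_J0 x
     + 2 / pi * (\<Sum>k. (-1) ^ (k + 1) * harm k * (x\<^sup>2 / 4) ^ k / (fact k)\<^sup>2)"

definition hankel1_0 :: "real \<Rightarrow> complex" where
  "hankel1_0 x = of_real (bessel_J0 x) + \<i> * of_real (bessel_Y0 x)"

definition fund_sol :: "nat \<Rightarrow> real \<Rightarrow> complex" where
  "fund_sol n x = (if n = 2 then \<i> / 4 * hankel1_0 x
                   else 1 / (4 * of_real pi) * (exp (\<i> * of_real x) / of_real x))"

definition grid :: "nat \<Rightarrow> nat \<Rightarrow> int vec set" where
  "grid n N = {q \<in> carrier_vec n. \<forall>k<n. - (real N / 2) < of_int (q $ k) \<and> of_int (q $ k) \<le> real N / 2}"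

abbreviation rvec :: "int vec \<Rightarrow> real vec" where
  "rvec \<equiv> map_vec real_of_int"

definition fund_sol_grid :: "nat \<Rightarrow> real \<Rightarrow> real \<Rightarrow> int vec \<Rightarrow> complex" where
  "fund_sol_grid n \<kappa> h q = (if q = 0\<^sub>v n then 0 else fund_sol n (\<kappa> * l2_norm (rvec q) * h))"

definition volume_matrix :: "nat \<Rightarrow> nat \<Rightarrow> real \<Rightarrow> real \<Rightarrow> (nat \<Rightarrow> int vec) \<Rightarrow> complex mat" where
  "volume_matrix n M \<kappa> h p =
     mat M M (\<lambda>(a, b). of_real (\<kappa> ^ n * h ^ n) * fund_sol_grid n \<kappa> h (p a - p b))"

definition far_field_const :: "nat \<Rightarrow> real \<Rightarrow> complex" where
  "far_field_const n \<kappa> =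
     (if n = 2 then of_real (\<kappa> powr (3 / 2)) * exp (\<i> * of_real pi / 4) / of_real (sqrt (8 * pi))
      else of_real (\<kappa>\<^sup>2 / (4 * pi)))"

definition far_field_matrix ::
  "nat \<Rightarrow> nat \<Rightarrow> nat \<Rightarrow> real \<Rightarrow> real \<Rightarrow> (nat \<Rightarrow> real vec) \<Rightarrow> (nat \<Rightarrow> int vec) \<Rightarrow> complex mat" where
  "far_field_matrix n M Q \<kappa> h xhat p =
     mat Q M (\<lambda>(a, b). far_field_const n \<kappa> * of_real (h ^ n) *
       exp (- (\<i> * of_real (\<kappa> * (xhat a \<bullet> rvec (p b)) * h))))"

definition incident_field ::
  "nat \<Rightarrow> real \<Rightarrow> real \<Rightarrow> (nat \<Rightarrow> int vec) \<Rightarrow> real vec \<Rightarrow> complex vec" where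
  "incident_field M \<kappa> h p d = vec M (\<lambda>b. exp (\<i> * of_real (\<kappa> * h * (rvec (p b) \<bullet> d))))"

definition distinct_directions :: "nat \<Rightarrow> nat \<Rightarrow> (nat \<Rightarrow> real vec) \<Rightarrow> bool" where
  "distinct_directions n K x \<longleftrightarrow>
     (\<forall>k<K. x k \<in> carrier_vec n \<and> l2_norm (x k) = 1) \<and> inj_on x {..<K}"

section \<open>Singular value decomposition\<close>

text \<open>The right singular vectors \<open>v 0, \<dots>, v (M - 1)\<close> are orthonormal in \<open>\<complex>\<^sup>M\<close>, hence a basis.
  Left singular vectors are only required to be orthonormal where the singular value is
  nonzero: the dimension \<open>Q\<close> may be smaller than \<open>M\<close>, and the remaining \<open>u k\<close> do not contribute
  to the sum.\<close>

definition is_svd ::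
  "complex mat \<Rightarrow> (nat \<Rightarrow> complex vec) \<Rightarrow> (nat \<Rightarrow> real) \<Rightarrow> (nat \<Rightarrow> complex vec) \<Rightarrow> nat \<Rightarrow> bool" where
  "is_svd A u \<sigma> v L0 \<longleftrightarrow>
     (let Q = dim_row A; M = dim_col A in
        L0 \<le> M \<and>
        (\<forall>k<M. u k \<in> carrier_vec Q \<and> v k \<in> carrier_vec M) \<and>
        (\<forall>k<M. \<forall>l<M. v k \<bullet>c v l = (if k = l then 1 else 0)) \<and>
        (\<forall>k<L0. \<forall>l<L0. u k \<bullet>c u l = (if k = l then 1 else 0)) \<and>
        (\<forall>k l. k \<le> l \<longrightarrow> l < L0 \<longrightarrow> \<sigma> l \<le> \<sigma> k) \<and>
        (\<forall>k<L0. 0 < \<sigma> k) \<and>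
        (\<forall>k. L0 \<le> k \<longrightarrow> k < M \<longrightarrow> \<sigma> k = 0) \<and>
        A = mat Q M (\<lambda>(a, b). \<Sum>k<M. u k $ a * of_real (\<sigma> k) * cnj (v k $ b)))"

definition signal_part ::
  "nat \<Rightarrow> nat \<Rightarrow> (nat \<Rightarrow> complex vec) \<Rightarrow> (nat \<Rightarrow> real) \<Rightarrow> (nat \<Rightarrow> complex vec) \<Rightarrow> complex vec \<Rightarrow> complex vec" where
  "signal_part M L\<alpha> u \<sigma> v y = vec M (\<lambda>i. \<Sum>k<L\<alpha>. (y \<bullet>c u k) / of_real (\<sigma> k) * v k $ i)"

definition noise_matrix :: "nat \<Rightarrow> nat \<Rightarrow> (nat \<Rightarrow> complex vec) \<Rightarrow> complex mat" where
  "noise_matrix M L\<alpha> v = mat_of_cols M (map v [L\<alpha>..<M])"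

section \<open>Objective function\<close>

record som_data =
  incidences :: nat  \<comment> \<open>\<open>J\<close>\<close>
  Tvol :: "complex mat"
  Tinf :: "complex mat"
  Vn :: "complex mat"
  omega_s :: "nat \<Rightarrow> complex vec"
  u_inc :: "nat \<Rightarrow> complex vec"
  u_inf :: "nat \<Rightarrow> complex vec"
  eta_s :: "nat \<Rightarrow> real"
  eta_d :: "nat \<Rightarrow> real"

definition omega :: "som_data \<Rightarrow> nat \<Rightarrow> complex vec \<Rightarrow> complex vec" where
  "omega D j a = omega_s D j + Vn D *\<^sub>v a"

definition Fsom_single :: "som_data \<Rightarrow> nat \<Rightarrow> complex vec \<Rightarrow> complex vec \<Rightarrow> real" where
  "Fsom_single D j a m =
     eta_s D j * (l2_norm (m \<odot> u_inc D j + m \<odot> (Tvol D *\<^sub>v omega D j a) - omega D j a))\<^sup>2 +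
     eta_d D j * (l2_norm (u_inf D j - Tinf D *\<^sub>v omega_s D j - Tinf D *\<^sub>v (Vn D *\<^sub>v a)))\<^sup>2"

definition Fsom :: "som_data \<Rightarrow> (nat \<Rightarrow> complex vec) \<Rightarrow> complex vec \<Rightarrow> real" where
  "Fsom D \<alpha> m = (\<Sum>j<incidences D. Fsom_single D j (\<alpha> j) m)"

definition grad_alpha :: "som_data \<Rightarrow> (nat \<Rightarrow> complex vec) \<Rightarrow> complex vec \<Rightarrow> nat \<Rightarrow> complex vec" where
  "grad_alpha D \<alpha> m j = complex_grad (\<lambda>a. Fsom D (\<alpha>(j := a)) m) (\<alpha> j)"

definition grad_m :: "som_data \<Rightarrow> (nat \<Rightarrow> complex vec) \<Rightarrow> complex vec \<Rightarrow> complex vec" where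
  "grad_m D \<alpha> m = complex_grad (\<lambda>m'. Fsom D \<alpha> m') m"

text \<open>The concatenated vector \<open>(\<alpha>\<^sub>1, \<dots>, \<alpha>\<^sub>J, m)\<close> of all variables.\<close>

definition stack :: "nat \<Rightarrow> (nat \<Rightarrow> complex vec) \<Rightarrow> complex vec \<Rightarrow> complex vec" where
  "stack J \<alpha> m = foldr (@\<^sub>v) (map \<alpha> [0..<J]) m"

definition grad_Fsom :: "som_data \<Rightarrow> (nat \<Rightarrow> complex vec) \<Rightarrow> complex vec \<Rightarrow> complex vec" where
  "grad_Fsom D \<alpha> m = stack (incidences D) (grad_alpha D \<alpha> m) (grad_m D \<alpha> m)"

section \<open>The IRSOM algorithm\<close>

definition search_direction :: "complex vec \<Rightarrow> complex vec \<Rightarrow> complex vec \<Rightarrow> complex vec" where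
  "search_direction g g_prev \<rho>_prev =
     (if g_prev \<noteq> 0\<^sub>v (dim_vec g_prev)
      then g + of_real (Re (g \<bullet>c (g - g_prev)) / (l2_norm g_prev)\<^sup>2) \<cdot>\<^sub>v \<rho>_prev
      else g)"

definition alpha_step_size ::
  "som_data \<Rightarrow> real \<Rightarrow> nat \<Rightarrow> complex vec \<Rightarrow> complex vec \<Rightarrow> complex vec \<Rightarrow> complex" where
  "alpha_step_size D \<gamma> j m g \<rho> =
     (let B = 2 * eta_s D j * (l2_norm (Vn D *\<^sub>v \<rho> - m \<odot> (Tvol D *\<^sub>v (Vn D *\<^sub>v \<rho>))))\<^sup>2
            + 2 * eta_d D j * (l2_norm (Tinf D *\<^sub>v (Vn D *\<^sub>v \<rho>)))\<^sup>2
      in if B = 0 then 0 else soft (\<gamma> * l1_norm \<rho> / B) (- (g \<bullet>c \<rho>) / of_real B))"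

definition m_update :: "som_data \<Rightarrow> real \<Rightarrow> (nat \<Rightarrow> complex vec) \<Rightarrow> complex vec \<Rightarrow> complex vec" where
  "m_update D \<beta> \<alpha> m =
     (let J = incidences D;
          \<omega> = (\<lambda>j. omega D j (\<alpha> j));
          U = (\<lambda>j. u_inc D j + Tvol D *\<^sub>v \<omega> j)
      in vec (dim_vec m) (\<lambda>l.
           if \<forall>j<J. U j $ l = 0 then m $ l
           else let A = (\<Sum>j<J. eta_s D j * (cmod (U j $ l))\<^sup>2);
                    z = (\<Sum>j<J. of_real (eta_s D j) * cnj (U j $ l) * \<omega> j $ l) / of_real A
                in m $ l + soft (\<beta> / (2 * A)) (z - m $ l)))"

text \<open>The state after \<open>r\<close> iterations also carries the gradients \<open>g\<^sub>j\<close> at the current iterate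
  and the search directions \<open>\<rho>\<^sub>j\<close> computed from them, as needed for the next direction.\<close>

record irsom_state =
  alpha_of :: "nat \<Rightarrow> complex vec"
  m_of :: "complex vec"
  g_of :: "nat \<Rightarrow> complex vec"
  rho_of :: "nat \<Rightarrow> complex vec"

primrec irsom :: "som_data \<Rightarrow> real \<Rightarrow> real \<Rightarrow> complex vec \<Rightarrow> nat \<Rightarrow> irsom_state" where
  "irsom D \<gamma> \<beta> m0 0 =
     (let \<alpha> = (\<lambda>j. 0\<^sub>v (dim_col (Vn D)));
          g = grad_alpha D \<alpha> m0
      in \<lparr>alpha_of = \<alpha>, m_of = m0, g_of = g, rho_of = g\<rparr>)"
| "irsom D \<gamma> \<beta> m0 (Suc r) =
     (let s = irsom D \<gamma> \<beta> m0 r;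
          \<alpha> = (\<lambda>j. alpha_of s j +
                    alpha_step_size D \<gamma> j (m_of s) (g_of s j) (rho_of s j) \<cdot>\<^sub>v rho_of s j);
          m = m_update D \<beta> \<alpha> (m_of s);
          g = grad_alpha D \<alpha> m
      in \<lparr>alpha_of = \<alpha>, m_of = m, g_of = g,
          rho_of = (\<lambda>j. search_direction (g j) (g_of s j) (rho_of s j))\<rparr>)"

text \<open>Norm convergence of the iterates \<open>z\<^sup>k = (\<alpha>\<^sup>k, m\<^sup>k)\<close> to \<open>z\<^sup>* = (\<alpha>', m')\<close> in the finite
  dimensional space of all variables.\<close>

definition iterates_tendsto ::
  "som_data \<Rightarrow> (nat \<Rightarrow> irsom_state) \<Rightarrow> (nat \<Rightarrow> complex vec) \<Rightarrow> complex vec \<Rightarrow> bool" where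
  "iterates_tendsto D s \<alpha>' m' \<longleftrightarrow>
     (\<forall>j<incidences D. \<alpha>' j \<in> carrier_vec (dim_col (Vn D))) \<and>
     m' \<in> carrier_vec (dim_row (Vn D)) \<and>
     (\<lambda>k. l2_norm (stack (incidences D) (alpha_of (s k)) (m_of (s k)) -
                    stack (incidences D) \<alpha>' m')) \<longlonglongrightarrow> 0"

end

theory Submission
  imports Defs
begin

text \<open>
  Both half steps minimise an exactly quadratic function plus an \<open>\<ell>\<^sub>1\<close> penalty, so soft thresholding
  decreases \<open>F\<close> by at least the penalty. As \<open>F \<ge> 0\<close>, the \<open>\<ell>\<^sub>1\<close> lengths of the steps are summable and the
  iterates converge. The optimality condition of the contrast step bounds the entries of
  \<open>\<nabla>\<^sub>m F\<close> by \<open>\<beta>\<close>; that of the line search gives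
  \<open>\<bar>\<langle>\<nabla>\<^sub>\<alpha> F(\<alpha>\<^sup>r\<^sup>+\<^sup>1, m\<^sup>r), \<rho>\<^sup>r\<rangle>\<bar> \<le> \<gamma> \<parallel>\<rho>\<^sup>r\<parallel>\<^sub>1 \<le> \<gamma> L \<parallel>\<rho>\<^sup>r\<parallel>\<close>. If the gradient limit \<open>g\<close> in \<open>\<alpha>\<^sub>j\<close> is nonzero, the conjugate
  gradient coefficients tend to 0, hence \<open>\<rho>\<^sup>r \<longlonglongrightarrow> g\<close> and \<open>\<parallel>g\<parallel>\<^sup>2 \<le> \<gamma> L \<parallel>g\<parallel>\<close>.
\<close>

section \<open>Vectors\<close>

lemma cscalar_prod_sum:
  fixes x y :: "complex vec"
  assumes "y \<in> carrier_vec n"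
  shows "x \<bullet>c y = (\<Sum>i<n. x $ i * cnj (y $ i))"
  using assms by (simp add: scalar_prod_def atLeast0LessThan)

lemma l2_norm_nonneg: "0 \<le> l2_norm x"
  by (simp add: l2_norm_def sum_nonneg)

lemma l1_norm_nonneg: "0 \<le> l1_norm x"
  by (simp add: l1_norm_def sum_nonneg)

lemma norm_le_l1_norm: "i < dim_vec x \<Longrightarrow> norm (x $ i) \<le> l1_norm x"
  unfolding l1_norm_def by (intro member_le_sum) auto

lemma l2_norm_power2: "(l2_norm x)\<^sup>2 = (\<Sum>i<dim_vec x. (norm (x $ i))\<^sup>2)"
  by (simp add: l2_norm_def sum_nonneg)

lemma norm_le_l2_norm:
  assumes "i < dim_vec x"
  shows "norm (x $ i) \<le> l2_norm x"
proof (rule power2_le_imp_le[OF _ l2_norm_nonneg])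
  show "(norm (x $ i))\<^sup>2 \<le> (l2_norm x)\<^sup>2"
    unfolding l2_norm_power2 using assms by (intro member_le_sum) auto
qed

lemma cscalar_prod_self:
  fixes x :: "complex vec"
  shows "x \<bullet>c x = of_real ((l2_norm x)\<^sup>2)"
  unfolding cscalar_prod_sum[OF carrier_vecI[OF refl]] l2_norm_power2
  by (simp only: of_real_sum complex_norm_square)

lemma l2_norm_eq_0_imp:
  assumes "l2_norm x = 0" "i < dim_vec x"
  shows "x $ i = 0"
  using norm_le_l2_norm[OF assms(2)] assms(1) by simp

text \<open>The factor 2 stays next to \<open>a * cnj b\<close> so that the linear term has the
  shape \<open>Re (cnj t * g)\<close> with \<open>g\<close> the complex gradient. All expansions of
  the objective below have this shape.\<close>

lemma cmod_add_mult_power2: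
  "(cmod (a + t * b))\<^sup>2 = (cmod a)\<^sup>2 + Re (cnj t * (2 * (a * cnj b))) + (cmod t)\<^sup>2 * (cmod b)\<^sup>2"
  by (simp add: cmod_power2) (simp add: power2_eq_square algebra_simps)

lemma l2_norm_add_smult_power2:
  assumes "x \<in> carrier_vec n" "y \<in> carrier_vec n"
  shows "(l2_norm (x + t \<cdot>\<^sub>v y))\<^sup>2 =
    (l2_norm x)\<^sup>2 + Re (cnj t * (2 * (x \<bullet>c y))) + (cmod t)\<^sup>2 * (l2_norm y)\<^sup>2"
proof -
  have "(l2_norm (x + t \<cdot>\<^sub>v y))\<^sup>2 = (\<Sum>i<n. (cmod (x $ i + t * y $ i))\<^sup>2)"
    using assms by (simp add: l2_norm_power2)
  also have "\<dots> = (l2_norm x)\<^sup>2 + (\<Sum>i<n. Re (cnj t * (2 * (x $ i * cnj (y $ i)))))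
      + (cmod t)\<^sup>2 * (l2_norm y)\<^sup>2"
    unfolding cmod_add_mult_power2 using assms
    by (simp add: l2_norm_power2 sum.distrib sum_distrib_left)
  also have "(\<Sum>i<n. Re (cnj t * (2 * (x $ i * cnj (y $ i))))) = Re (cnj t * (2 * (x \<bullet>c y)))"
    unfolding cscalar_prod_sum[OF assms(2)] by (simp only: Re_sum sum_distrib_left)
  finally show ?thesis .
qed

text \<open>The vector on the right is the adjoint of \<open>K\<close> applied to \<open>x\<close>,
  entry by entry. This is what turns the derivative of a squared residual into an explicit gradient
  vector.\<close>

lemma cscalar_prod_mult_mat_vec:
  fixes x \<rho> :: "complex vec"
  assumes "K \<in> carrier_mat m n" "\<rho> \<in> carrier_vec n"
  shows "x \<bullet>c (K *\<^sub>v \<rho>) = vec n (\<lambda>l. x \<bullet>c col K l) \<bullet>c \<rho>"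
proof -
  have "x \<bullet>c (K *\<^sub>v \<rho>) = (\<Sum>i<m. \<Sum>l<n. x $ i * cnj (K $$ (i, l)) * cnj (\<rho> $ l))"
    unfolding cscalar_prod_sum[OF mult_mat_vec_carrier[OF assms]] using assms
    by (intro sum.cong refl)
      (simp add: scalar_prod_def atLeast0LessThan sum_distrib_left mult.assoc)
  also have "\<dots> = (\<Sum>l<n. \<Sum>i<m. x $ i * cnj (K $$ (i, l)) * cnj (\<rho> $ l))"
    by (rule sum.swap)
  also have "\<dots> = (\<Sum>l<n. (x \<bullet>c col K l) * cnj (\<rho> $ l))"
  proof (intro sum.cong refl)
    fix l assume "l \<in> {..<n}"
    then show "(\<Sum>i<m. x $ i * cnj (K $$ (i, l)) * cnj (\<rho> $ l)) = (x \<bullet>c col K l) * cnj (\<rho> $ l)"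
      unfolding sum_distrib_right[symmetric] using assms
      by (subst cscalar_prod_sum[where n = m]) auto
  qed
  also have "\<dots> = vec n (\<lambda>l. x \<bullet>c col K l) \<bullet>c \<rho>"
    unfolding cscalar_prod_sum[OF assms(2)] by simp
  finally show ?thesis .
qed

lemma cscalar_prod_add_smult_left:
  fixes x y z :: "complex vec"
  assumes "x \<in> carrier_vec n" "y \<in> carrier_vec n" "z \<in> carrier_vec n"
  shows "(x + s \<cdot>\<^sub>v y) \<bullet>c z = x \<bullet>c z + s * (y \<bullet>c z)"
  unfolding cscalar_prod_sum[OF assms(3)] using assms
  by (simp add: sum.distrib sum_distrib_left algebra_simps)

lemma l1_norm_smult: "l1_norm (s \<cdot>\<^sub>v x) = cmod s * l1_norm x"
  by (simp add: l1_norm_def norm_mult sum_distrib_left)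

lemma linf_norm_le_iff: "linf_norm x \<le> e \<longleftrightarrow> 0 \<le> e \<and> (\<forall>i<dim_vec x. norm (x $ i) \<le> e)"
  unfolding linf_norm_def by auto

lemma linf_norm_append_le:
  assumes "linf_norm x \<le> e" "linf_norm y \<le> e"
  shows "linf_norm (x @\<^sub>v y) \<le> e"
  using assms unfolding linf_norm_le_iff by (auto simp: index_append_vec)

text \<open>\<open>stack\<close> is a fold over \<open>[0..<J]\<close>, so the induction runs over
  arbitrary lists of admissible indices.\<close>

lemma linf_norm_stack_le:
  assumes "\<And>j. j < J \<Longrightarrow> linf_norm (\<alpha> j) \<le> e" "linf_norm m \<le> e"
  shows "linf_norm (stack J \<alpha> m) \<le> e"
proof -
  have "linf_norm (foldr (@\<^sub>v) (map \<alpha> js) m) \<le> e" if "set js \<subseteq> {..<J}" for js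
    using that assms by (induction js) (auto intro!: linf_norm_append_le)
  from this[of "[0..<J]"] show ?thesis unfolding stack_def by (simp add: subset_iff)
qed

lemma l2_norm_append_power2: "(l2_norm (x @\<^sub>v y))\<^sup>2 = (l2_norm x)\<^sup>2 + (l2_norm y)\<^sup>2"
proof -
  have shift: "sum f {..<a + b} = sum f {..<a} + (\<Sum>i<b. f (a + i))" for f :: "nat \<Rightarrow> real" and a b
    by (induction b) auto
  have "(\<Sum>i<dim_vec x + dim_vec y. (norm ((x @\<^sub>v y) $ i))\<^sup>2) =
      (\<Sum>i<dim_vec x. (norm ((x @\<^sub>v y) $ i))\<^sup>2) +
      (\<Sum>i<dim_vec y. (norm ((x @\<^sub>v y) $ (dim_vec x + i)))\<^sup>2)"
    by (rule shift)
  then show ?thesis by (simp add: l2_norm_power2 index_append_vec)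
qed

text \<open>Reduces norm convergence of the stacked iterates to that of each block. The induction
  also carries equality of the two stacked dimensions, without which the difference cannot be split
  along the append.\<close>

lemma l2_norm_stack_diff_power2:
  assumes "\<And>j. j < J \<Longrightarrow> \<alpha> j \<in> carrier_vec n \<and> \<alpha>' j \<in> carrier_vec n"
    and "m \<in> carrier_vec M" "m' \<in> carrier_vec M"
  shows "(l2_norm (stack J \<alpha> m - stack J \<alpha>' m'))\<^sup>2 =
    (\<Sum>j<J. (l2_norm (\<alpha> j - \<alpha>' j))\<^sup>2) + (l2_norm (m - m'))\<^sup>2"
proof -
  let ?S = "\<lambda>\<alpha> m js. foldr (@\<^sub>v) (map \<alpha> js) m"
  have "?S \<alpha> m js \<in> carrier_vec (dim_vec (?S \<alpha>' m' js)) \<and>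
      (l2_norm (?S \<alpha> m js - ?S \<alpha>' m' js))\<^sup>2 =
      (\<Sum>j\<leftarrow>js. (l2_norm (\<alpha> j - \<alpha>' j))\<^sup>2) + (l2_norm (m - m'))\<^sup>2"
    if "set js \<subseteq> {..<J}" for js
    using that
  proof (induction js)
    case Nil
    then show ?case using assms by auto
  next
    case (Cons j js)
    then have dims: "\<alpha> j \<in> carrier_vec n" "\<alpha>' j \<in> carrier_vec n" using assms(1) by auto
    have IH: "dim_vec (?S \<alpha> m js) = dim_vec (?S \<alpha>' m' js)" using Cons by auto
    have "(\<alpha> j @\<^sub>v ?S \<alpha> m js) - (\<alpha>' j @\<^sub>v ?S \<alpha>' m' js) =
        (\<alpha> j - \<alpha>' j) @\<^sub>v (?S \<alpha> m js - ?S \<alpha>' m' js)"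
      using dims IH by (intro eq_vecI) (auto simp: index_append_vec)
    then show ?case using Cons dims IH by (auto simp: l2_norm_append_power2)
  qed
  from this[of "[0..<J]"] show ?thesis
    unfolding stack_def by (simp add: subset_iff interv_sum_list_conv_sum_set_nat lessThan_atLeast0)
qed

text \<open>The dimension of a \<open>vec\<close> is part of its value, so one common dimension is
  fixed for all terms and the limit. Entrywise convergence is then equivalent to norm
  convergence.\<close>

definition vec_tendsto :: "nat \<Rightarrow> (nat \<Rightarrow> complex vec) \<Rightarrow> complex vec \<Rightarrow> bool" where
  "vec_tendsto n x y \<longleftrightarrow> y \<in> carrier_vec n \<and> (\<forall>k. x k \<in> carrier_vec n) \<and>
     (\<forall>i<n. (\<lambda>k. x k $ i) \<longlonglongrightarrow> y $ i)"

lemma vec_tendsto_Suc: "vec_tendsto n x y \<Longrightarrow> vec_tendsto n (\<lambda>k. x (Suc k)) y"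
  unfolding vec_tendsto_def by (auto intro: LIMSEQ_Suc)

lemma vec_tendsto_diff:
  "vec_tendsto n x x' \<Longrightarrow> vec_tendsto n y y' \<Longrightarrow> vec_tendsto n (\<lambda>k. x k - y k) (x' - y')"
  unfolding vec_tendsto_def carrier_vec_def by (auto intro: tendsto_diff)

lemma vec_tendsto_add:
  "vec_tendsto n x x' \<Longrightarrow> vec_tendsto n y y' \<Longrightarrow> vec_tendsto n (\<lambda>k. x k + y k) (x' + y')"
  unfolding vec_tendsto_def carrier_vec_def by (auto intro: tendsto_add)

lemma vec_tendsto_hadamard:
  "vec_tendsto n x x' \<Longrightarrow> vec_tendsto n y y' \<Longrightarrow> vec_tendsto n (\<lambda>k. x k \<odot> y k) (x' \<odot> y')"
  unfolding vec_tendsto_def carrier_vec_def hadamard_def by (auto intro: tendsto_mult)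

lemma vec_tendsto_const: "x \<in> carrier_vec n \<Longrightarrow> vec_tendsto n (\<lambda>k. x) x"
  unfolding vec_tendsto_def by auto

lemma vec_tendsto_vec:
  assumes "\<And>i. i < n \<Longrightarrow> (\<lambda>k. f k i) \<longlonglongrightarrow> g i"
  shows "vec_tendsto n (\<lambda>k. vec n (f k)) (vec n g)"
  unfolding vec_tendsto_def using assms by auto

lemma vec_tendsto_mult_mat_vec:
  assumes "K \<in> carrier_mat m n" "vec_tendsto n x y"
  shows "vec_tendsto m (\<lambda>k. K *\<^sub>v x k) (K *\<^sub>v y)"
proof -
  have dims: "dim_vec y = n" "\<And>k. dim_vec (x k) = n" "dim_row K = m"
    using assms unfolding vec_tendsto_def by auto
  show ?thesis
    unfolding mult_mat_vec_def scalar_prod_def dims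
    using assms unfolding vec_tendsto_def
    by (intro vec_tendsto_vec[unfolded vec_tendsto_def] tendsto_intros) auto
qed

lemma tendsto_cscalar_prod:
  assumes "vec_tendsto n x x'" "vec_tendsto n y y'"
  shows "(\<lambda>k. x k \<bullet>c y k) \<longlonglongrightarrow> x' \<bullet>c y'"
proof -
  have y: "y' \<in> carrier_vec n" "\<And>k. y k \<in> carrier_vec n"
    using assms unfolding vec_tendsto_def by auto
  show ?thesis unfolding cscalar_prod_sum[OF y(1)] cscalar_prod_sum[OF y(2)]
    using assms unfolding vec_tendsto_def by (intro tendsto_intros) auto
qed

lemma tendsto_l2_norm:
  assumes "vec_tendsto n x x'"
  shows "(\<lambda>k. l2_norm (x k)) \<longlonglongrightarrow> l2_norm x'"
proof -
  have dims: "dim_vec x' = n" "\<And>k. dim_vec (x k) = n"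
    using assms unfolding vec_tendsto_def by auto
  show ?thesis unfolding l2_norm_def dims
    using assms unfolding vec_tendsto_def by (intro tendsto_intros) auto
qed

lemma vec_tendstoI_l2_norm:
  assumes "(\<lambda>k. l2_norm (x k - y)) \<longlonglongrightarrow> 0" "y \<in> carrier_vec n" "\<And>k. x k \<in> carrier_vec n"
  shows "vec_tendsto n x y"
  unfolding vec_tendsto_def
proof (intro conjI allI impI assms)
  fix i assume i: "i < n"
  have "(\<lambda>k. x k $ i - y $ i) \<longlonglongrightarrow> 0"
  proof (rule Lim_null_comparison[OF _ assms(1)], rule always_eventually, rule allI)
    fix k
    show "norm (x k $ i - y $ i) \<le> l2_norm (x k - y)"
      using norm_le_l2_norm[of i "x k - y"] assms i by auto
  qed
  then show "(\<lambda>k. x k $ i) \<longlonglongrightarrow> y $ i" by (rule LIM_zero_cancel)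
qed

section \<open>Soft thresholding\<close>

text \<open>This is the optimality condition of the minimiser of
  \<open>|s - z|^2 / 2 + \<tau> |s|\<close>: the difference has modulus exactly \<tau> above the
  threshold and equals \<open>- z\<close> below it.\<close>

lemma soft_diff_le:
  assumes "0 \<le> \<tau>"
  shows "cmod (soft \<tau> z - z) \<le> \<tau>"
proof (cases "cmod z > \<tau>")
  case True
  then have "z \<noteq> 0" using assms by auto
  then have "soft \<tau> z - z = - (of_real \<tau> * (z / of_real (cmod z)))"
    using True by (simp add: soft_def field_simps)
  then show ?thesis using assms \<open>z \<noteq> 0\<close> by (simp add: norm_mult norm_divide)
qed (simp add: soft_def)

text \<open>Compares the value of \<open>|s - z|^2 / 2 + \<tau> |s|\<close> at its minimiser with
  the value at \<open>s = 0\<close>; the common term \<open>|z|^2 / 2\<close> has been cancelled.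
  Above the threshold the difference is exactly \<open>- (|z| - \<tau>)^2 / 2\<close>.\<close>

lemma soft_descent:
  assumes "0 \<le> \<tau>"
  shows "(cmod (soft \<tau> z))\<^sup>2 / 2 - Re (cnj (soft \<tau> z) * z) + \<tau> * cmod (soft \<tau> z) \<le> 0"
proof (cases "cmod z > \<tau>")
  case True
  then have z: "z \<noteq> 0" using assms by auto
  have s: "soft \<tau> z = of_real ((cmod z - \<tau>) / cmod z) * z"
    using True by (simp add: soft_def)
  have n: "cmod (soft \<tau> z) = cmod z - \<tau>"
    unfolding s norm_mult norm_of_real using True z assms by simp
  have "cnj (soft \<tau> z) * z = of_real ((cmod z - \<tau>) / cmod z) * (z * cnj z)"
    unfolding s by simp
  also have "\<dots> = of_real ((cmod z - \<tau>) / cmod z * (cmod z)\<^sup>2)"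
    by (simp only: of_real_mult complex_norm_square)
  also have "(cmod z - \<tau>) / cmod z * (cmod z)\<^sup>2 = (cmod z - \<tau>) * cmod z"
    using z by (simp add: power2_eq_square)
  finally have "Re (cnj (soft \<tau> z) * z) = (cmod z - \<tau>) * cmod z" by simp
  then have "(cmod (soft \<tau> z))\<^sup>2 / 2 - Re (cnj (soft \<tau> z) * z) + \<tau> * cmod (soft \<tau> z)
      = - ((cmod z - \<tau>)\<^sup>2 / 2)"
    unfolding n by (simp add: power2_eq_square field_simps)
  then show ?thesis by simp
qed (simp add: soft_def)

section \<open>Sequences\<close>

text \<open>Telescoping the descent inequality bounds every partial sum of \<open>d\<close> by
  \<open>f 0\<close>, because \<open>f\<close> stays nonnegative.\<close>

lemma summable_of_descent:
  fixes f d :: "nat \<Rightarrow> real"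
  assumes "\<And>k. 0 \<le> f k" "\<And>k. 0 \<le> d k" "\<And>k. f (Suc k) + d k \<le> f k"
  shows "summable d"
proof (rule summableI_nonneg_bounded[OF assms(2)])
  fix k
  have "f k + (\<Sum>i<k. d i) \<le> f 0"
  proof (induction k)
    case (Suc k)
    then show ?case using assms(3)[of k] by simp
  qed simp
  then show "(\<Sum>i<k. d i) \<le> f 0" using assms(1)[of k] by simp
qed

lemma convergent_of_summable_increments:
  fixes x :: "nat \<Rightarrow> 'a::banach"
  assumes "summable d" "\<And>k. norm (x (Suc k) - x k) \<le> d k"
  shows "convergent x"
proof -
  have "summable (\<lambda>k. x (Suc k) - x k)"
    using assms(2) by (intro summable_comparison_test'[OF assms(1), of 0]) auto
  then have "(\<lambda>n. x n - x 0) \<longlonglongrightarrow> suminf (\<lambda>k. x (Suc k) - x k)"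
    using summable_LIMSEQ[of "\<lambda>k. x (Suc k) - x k"] by (simp add: sum_lessThan_telescope)
  from tendsto_add[OF this tendsto_const[of "x 0"]] show ?thesis
    by (auto simp: convergent_def)
qed

text \<open>Models one entry of the conjugate gradient direction. Once the coefficients are below
  1/2 the recursion keeps \<open>x\<close> bounded, so the feedback term \<open>c k * x k\<close>
  vanishes in the limit and only \<open>y\<close> remains.\<close>

lemma tendsto_contracting_recursion:
  fixes x y :: "nat \<Rightarrow> 'a::real_normed_field"
  assumes rec: "eventually (\<lambda>k. x (Suc k) = y k + c k * x k) sequentially"
    and y: "y \<longlonglongrightarrow> b" and c: "c \<longlonglongrightarrow> 0"
  shows "x \<longlonglongrightarrow> b"
proof -
  obtain C where C: "\<And>k. norm (y k) \<le> C"
    using convergent_imp_Bseq[OF convergentI[OF y]] by (auto simp: Bseq_def)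
  have "eventually (\<lambda>k. norm (c k) < 1/2) sequentially"
    using tendstoD[OF c, of "1/2"] by (simp add: dist_norm)
  with rec obtain K where K: "\<And>k. k \<ge> K \<Longrightarrow> x (Suc k) = y k + c k * x k \<and> norm (c k) < 1/2"
    using eventually_conj unfolding eventually_sequentially by (metis (no_types, lifting) le_trans linorder_linear)
  \<comment> \<open>\<open>X\<close> bounds the starting term and satisfies
    \<open>C + X / 2 \<le> X\<close>, so the recursion preserves the bound.\<close>
  define X where "X = max (norm (x K)) (2 * C)"
  have X: "norm (x (K + i)) \<le> X" for i
  proof (induction i)
    case (Suc i)
    have "norm (x (K + Suc i)) \<le> norm (y (K + i)) + norm (c (K + i)) * norm (x (K + i))"
      using K[of "K + i"] norm_triangle_ineq[of "y (K + i)" "c (K + i) * x (K + i)"]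
      by (simp add: norm_mult)
    also have "\<dots> \<le> C + 1/2 * X"
      using Suc K[of "K + i"] by (intro add_mono mult_mono C) auto
    also have "\<dots> \<le> X" unfolding X_def by auto
    finally show ?case .
  qed (simp add: X_def)
  have "(\<lambda>i. c (i + K) * x (i + K)) \<longlonglongrightarrow> 0"
  proof (rule Lim_null_comparison)
    show "\<forall>\<^sub>F i in sequentially. norm (c (i + K) * x (i + K)) \<le> norm (c (i + K)) * X"
      using X by (auto simp: norm_mult add.commute intro!: always_eventually mult_left_mono)
    show "(\<lambda>i. norm (c (i + K)) * X) \<longlonglongrightarrow> 0"
      using tendsto_mult_left_zero[OF tendsto_norm_zero[OF LIMSEQ_ignore_initial_segment[OF c, of K]]] .
  qed
  from tendsto_add[OF LIMSEQ_ignore_initial_segment[OF y, of K] this]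
  have "(\<lambda>i. y (i + K) + c (i + K) * x (i + K)) \<longlonglongrightarrow> b" by simp
  then have "(\<lambda>i. x (i + Suc K)) \<longlonglongrightarrow> b" using K by simp
  then show ?thesis by (rule LIMSEQ_offset)
qed

section \<open>Complex gradients of quadratic functions\<close>

text \<open>A single expansion with complex \<open>t\<close> yields both partial derivatives: real
  \<open>t\<close> picks out the real part of \<open>g $ l\<close>, purely imaginary
  \<open>t\<close> its imaginary part. The quadratic term has derivative 0 at the origin.\<close>

lemma complex_grad_eqI:
  assumes "g \<in> carrier_vec (dim_vec w)"
    and q: "\<And>l t. l < dim_vec w \<Longrightarrow>
      \<psi> (w + t \<cdot>\<^sub>v unit_vec (dim_vec w) l) = \<psi> w + Re (cnj t * g $ l) + (cmod t)\<^sup>2 * c l"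
  shows "complex_grad \<psi> w = g"
proof (rule eq_vecI)
  show "dim_vec (complex_grad \<psi> w) = dim_vec g" using assms by (simp add: complex_grad_def)
  fix l assume "l < dim_vec g"
  then have l: "l < dim_vec w" using assms by simp
  have "((\<lambda>t. \<psi> w + t * Re (g $ l) + t\<^sup>2 * c l) has_field_derivative Re (g $ l)) (at 0)"
    by (auto intro!: derivative_eq_intros)
  then have 1: "deriv (\<lambda>t. \<psi> (w + of_real t \<cdot>\<^sub>v unit_vec (dim_vec w) l)) 0 = Re (g $ l)"
    unfolding q[OF l] by (intro DERIV_imp_deriv) simp
  have "((\<lambda>t. \<psi> w + t * Im (g $ l) + t\<^sup>2 * c l) has_field_derivative Im (g $ l)) (at 0)"
    by (auto intro!: derivative_eq_intros)
  then have 2: "deriv (\<lambda>t. \<psi> (w + (\<i> * of_real t) \<cdot>\<^sub>v unit_vec (dim_vec w) l)) 0 = Im (g $ l)"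
    unfolding q[OF l] by (intro DERIV_imp_deriv) (simp add: norm_mult)
  show "complex_grad \<psi> w $ l = g $ l"
    using l 1 2 by (simp add: complex_grad_def complex_eq[symmetric])
qed

section \<open>The objective function\<close>

lemma cscalar_prod_unit_vec:
  fixes x :: "complex vec"
  assumes "l < n"
  shows "x \<bullet>c unit_vec n l = x $ l"
proof -
  have "x \<bullet>c unit_vec n l = (\<Sum>i<n. if i = l then x $ i else 0)"
    unfolding cscalar_prod_sum[OF unit_vec_carrier] using assms
    by (intro sum.cong refl) (simp add: unit_vec_def)
  also have "\<dots> = x $ l" using assms by (simp add: sum.delta)
  finally show ?thesis .
qed

lemma hadamard_carrier: "x \<in> carrier_vec n \<Longrightarrow> x \<odot> y \<in> carrier_vec n"
  unfolding hadamard_def by (rule carrier_vecI) (drule carrier_vecD, simp only: dim_vec)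

lemma index_hadamard: "i < dim_vec x \<Longrightarrow> (x \<odot> y) $ i = x $ i * y $ i"
  by (simp add: hadamard_def)

lemma dim_hadamard: "dim_vec (x \<odot> y) = dim_vec x"
  by (simp add: hadamard_def)

lemma l2_norm_minus_commute:
  assumes "x \<in> carrier_vec n" "y \<in> carrier_vec n"
  shows "l2_norm (x - y) = l2_norm (y - x)"
proof -
  have "dim_vec (x - y) = dim_vec (y - x)" using assms by simp
  moreover have "norm ((x - y) $ i) = norm ((y - x) $ i)" if "i < dim_vec (y - x)" for i
    using assms that norm_minus_commute[of "x $ i"] by simp
  ultimately show ?thesis unfolding l2_norm_def
    by (intro arg_cong[of _ _ sqrt] sum.cong) (simp_all only: lessThan_iff)
qed

text \<open>Here \<open>N\<close> is the dimension of each block of \<alpha> and will be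
  instantiated with \<open>M - L\<alpha>\<close>; it is not the mesh parameter called
  \<open>N\<close> in the final theorem.\<close>

locale som_problem =
  fixes D :: som_data and M N Q :: nat
  assumes Tvol: "Tvol D \<in> carrier_mat M M"
    and Tinf: "Tinf D \<in> carrier_mat Q M"
    and Vn: "Vn D \<in> carrier_mat M N"
    and omega_s: "j < incidences D \<Longrightarrow> omega_s D j \<in> carrier_vec M"
    and u_inc: "j < incidences D \<Longrightarrow> u_inc D j \<in> carrier_vec M"
    and u_inf: "j < incidences D \<Longrightarrow> u_inf D j \<in> carrier_vec Q"
    and eta_s_pos: "j < incidences D \<Longrightarrow> 0 < eta_s D j"
    and eta_d_pos: "j < incidences D \<Longrightarrow> 0 < eta_d D j"
begin

text \<open>For fixed \<open>m\<close> the objective is a sum of squared norms of residuals affine in \<open>\<alpha>\<^sub>j\<close>, with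
  linear parts \<open>state_mat m\<close> and \<open>- data_mat\<close>.\<close>

definition state_mat :: "complex vec \<Rightarrow> complex mat" where
  "state_mat m = mat M N (\<lambda>(i, l). m $ i * (Tvol D * Vn D) $$ (i, l) - Vn D $$ (i, l))"

definition data_mat :: "complex mat" where
  "data_mat = Tinf D * Vn D"

definition state_res :: "nat \<Rightarrow> complex vec \<Rightarrow> complex vec \<Rightarrow> complex vec" where
  "state_res j a m = m \<odot> u_inc D j + m \<odot> (Tvol D *\<^sub>v omega D j a) - omega D j a"

definition data_res :: "nat \<Rightarrow> complex vec \<Rightarrow> complex vec" where
  "data_res j a = u_inf D j - Tinf D *\<^sub>v omega_s D j - Tinf D *\<^sub>v (Vn D *\<^sub>v a)"

text \<open>Each term is the adjoint of a linear part applied to its residual. The minus sign arises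
  because the data residual has linear part \<open>- data_mat\<close>.\<close>

definition grad_single :: "nat \<Rightarrow> complex vec \<Rightarrow> complex vec \<Rightarrow> complex vec" where
  "grad_single j a m = vec N (\<lambda>l.
     of_real (2 * eta_s D j) * (state_res j a m \<bullet>c col (state_mat m) l) -
     of_real (2 * eta_d D j) * (data_res j a \<bullet>c col data_mat l))"

text \<open>Twice the coefficient of \<open>|t|^2\<close> in the objective along \<rho>; it is the
  number \<open>B\<close> of the step size rule.\<close>

definition curvature :: "nat \<Rightarrow> complex vec \<Rightarrow> complex vec \<Rightarrow> real" where
  "curvature j m \<rho> = 2 * eta_s D j * (l2_norm (state_mat m *\<^sub>v \<rho>))\<^sup>2 +
     2 * eta_d D j * (l2_norm (data_mat *\<^sub>v \<rho>))\<^sup>2"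

definition total_field :: "nat \<Rightarrow> complex vec \<Rightarrow> complex vec" where
  "total_field j a = u_inc D j + Tvol D *\<^sub>v omega D j a"

text \<open>The number \<open>A\<close> of the contrast update, which is also the quadratic
  coefficient of the objective in the single entry \<open>l\<close> of \<open>m\<close>.\<close>

definition field_weight :: "(nat \<Rightarrow> complex vec) \<Rightarrow> nat \<Rightarrow> real" where
  "field_weight \<alpha> l = (\<Sum>j<incidences D. eta_s D j * (cmod (total_field j (\<alpha> j) $ l))\<^sup>2)"

definition grad_contrast :: "(nat \<Rightarrow> complex vec) \<Rightarrow> complex vec \<Rightarrow> complex vec" where
  "grad_contrast \<alpha> m = vec M (\<lambda>l. \<Sum>j<incidences D.
     of_real (2 * eta_s D j) * (state_res j (\<alpha> j) m $ l * cnj (total_field j (\<alpha> j) $ l)))"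

lemma state_mat_carrier: "state_mat m \<in> carrier_mat M N"
  by (simp add: state_mat_def)

lemma data_mat_carrier: "data_mat \<in> carrier_mat Q N"
  using Tinf Vn by (simp add: data_mat_def)

lemma omega_carrier: "j < incidences D \<Longrightarrow> a \<in> carrier_vec N \<Longrightarrow> omega D j a \<in> carrier_vec M"
  unfolding omega_def by (rule add_carrier_vec[OF omega_s mult_mat_vec_carrier[OF Vn]])

lemma state_res_carrier:
  "j < incidences D \<Longrightarrow> a \<in> carrier_vec N \<Longrightarrow> m \<in> carrier_vec M \<Longrightarrow> state_res j a m \<in> carrier_vec M"
  unfolding state_res_def
  by (rule minus_carrier_vec[OF add_carrier_vec[OF hadamard_carrier hadamard_carrier] omega_carrier])

lemma data_res_carrier:
  "j < incidences D \<Longrightarrow> a \<in> carrier_vec N \<Longrightarrow> data_res j a \<in> carrier_vec Q"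
  unfolding data_res_def
  by (rule minus_carrier_vec[OF minus_carrier_vec[OF u_inf mult_mat_vec_carrier[OF Tinf omega_s]]
      mult_mat_vec_carrier[OF Tinf mult_mat_vec_carrier[OF Vn]]])

lemma grad_single_carrier: "grad_single j a m \<in> carrier_vec N"
  by (simp add: grad_single_def)

lemma grad_contrast_carrier: "grad_contrast \<alpha> m \<in> carrier_vec M"
  by (simp add: grad_contrast_def)

lemma Fsom_single_eq:
  "Fsom_single D j a m =
     eta_s D j * (l2_norm (state_res j a m))\<^sup>2 + eta_d D j * (l2_norm (data_res j a))\<^sup>2"
  by (simp add: Fsom_single_def state_res_def data_res_def)

lemma Fsom_nonneg: "0 \<le> Fsom D \<alpha> m"
  unfolding Fsom_def Fsom_single_eq
  using less_imp_le[OF eta_s_pos] less_imp_le[OF eta_d_pos]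
  by (intro sum_nonneg add_nonneg_nonneg mult_nonneg_nonneg) auto

lemma state_mat_mult_vec:
  assumes "m \<in> carrier_vec M" "\<rho> \<in> carrier_vec N"
  shows "state_mat m *\<^sub>v \<rho> = m \<odot> (Tvol D *\<^sub>v (Vn D *\<^sub>v \<rho>)) - Vn D *\<^sub>v \<rho>"
proof -
  define W where "W = Tvol D * Vn D"
  have W: "W \<in> carrier_mat M N" unfolding W_def using Tvol Vn by simp
  have "Tvol D *\<^sub>v (Vn D *\<^sub>v \<rho>) = W *\<^sub>v \<rho>"
    unfolding W_def using Tvol Vn assms by (simp add: assoc_mult_mat_vec)
  moreover have "state_mat m *\<^sub>v \<rho> = m \<odot> (W *\<^sub>v \<rho>) - Vn D *\<^sub>v \<rho>"
    unfolding state_mat_def W_def[symmetric] using W Vn assms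
    by (intro eq_vecI)
      (auto simp: scalar_prod_def index_hadamard dim_hadamard sum_distrib_left sum_subtractf
        left_diff_distrib mult.assoc)
  ultimately show ?thesis by simp
qed

lemma omega_add:
  assumes "j < incidences D" "a \<in> carrier_vec N" "\<rho> \<in> carrier_vec N"
  shows "omega D j (a + t \<cdot>\<^sub>v \<rho>) = omega D j a + t \<cdot>\<^sub>v (Vn D *\<^sub>v \<rho>)"
proof -
  have "Vn D *\<^sub>v (a + t \<cdot>\<^sub>v \<rho>) = Vn D *\<^sub>v a + t \<cdot>\<^sub>v (Vn D *\<^sub>v \<rho>)"
    using assms Vn by (simp add: mult_add_distrib_mat_vec mult_mat_vec)
  then show ?thesis unfolding omega_def
    using assms Vn omega_s by (simp add: assoc_add_vec[of _ M] mult_mat_vec_carrier[of _ M N])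
qed

lemma state_res_add:
  assumes "j < incidences D" "a \<in> carrier_vec N" "m \<in> carrier_vec M" "\<rho> \<in> carrier_vec N"
  shows "state_res j (a + t \<cdot>\<^sub>v \<rho>) m = state_res j a m + t \<cdot>\<^sub>v (state_mat m *\<^sub>v \<rho>)"
proof -
  define w r where "w = omega D j a" and "r = Vn D *\<^sub>v \<rho>"
  have wr: "w \<in> carrier_vec M" "r \<in> carrier_vec M"
    unfolding w_def r_def using assms omega_carrier Vn by auto
  define tw tr where "tw = Tvol D *\<^sub>v w" and "tr = Tvol D *\<^sub>v r"
  have tr: "Tvol D *\<^sub>v (w + t \<cdot>\<^sub>v r) = tw + t \<cdot>\<^sub>v tr"
    unfolding tw_def tr_def using wr Tvol by (simp add: mult_add_distrib_mat_vec mult_mat_vec)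
  have "tw \<in> carrier_vec M" "tr \<in> carrier_vec M"
    unfolding tw_def tr_def using Tvol wr by auto
  then show ?thesis
    unfolding state_res_def omega_add[OF assms(1,2,4)] state_mat_mult_vec[OF assms(3,4)]
      w_def[symmetric] r_def[symmetric] tr tw_def[symmetric] tr_def[symmetric]
    using wr assms u_inc by (intro eq_vecI) (auto simp: index_hadamard dim_hadamard algebra_simps)
qed

lemma data_res_add:
  assumes "j < incidences D" "a \<in> carrier_vec N" "\<rho> \<in> carrier_vec N"
  shows "data_res j (a + t \<cdot>\<^sub>v \<rho>) = data_res j a + (- t) \<cdot>\<^sub>v (data_mat *\<^sub>v \<rho>)"
proof -
  define w r where "w = Vn D *\<^sub>v a" and "r = Vn D *\<^sub>v \<rho>"
  have wr: "w \<in> carrier_vec M" "r \<in> carrier_vec M"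
    unfolding w_def r_def using assms Vn by auto
  have 1: "Vn D *\<^sub>v (a + t \<cdot>\<^sub>v \<rho>) = w + t \<cdot>\<^sub>v r"
    unfolding w_def r_def using assms Vn by (simp add: mult_add_distrib_mat_vec mult_mat_vec)
  have 2: "Tinf D *\<^sub>v (w + t \<cdot>\<^sub>v r) = Tinf D *\<^sub>v w + t \<cdot>\<^sub>v (Tinf D *\<^sub>v r)"
    using wr Tinf by (simp add: mult_add_distrib_mat_vec mult_mat_vec)
  have 3: "data_mat *\<^sub>v \<rho> = Tinf D *\<^sub>v r"
    unfolding data_mat_def r_def using Tinf Vn assms by (simp add: assoc_mult_mat_vec)
  show ?thesis
    unfolding data_res_def 1 2 3 w_def[symmetric] using wr assms u_inf Tinf
    by (intro eq_vecI) (auto simp del: index_mult_mat_vec)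
qed

lemma grad_single_cscalar_prod:
  assumes "\<rho> \<in> carrier_vec N"
  shows "grad_single j a m \<bullet>c \<rho> =
    of_real (2 * eta_s D j) * (state_res j a m \<bullet>c (state_mat m *\<^sub>v \<rho>)) -
    of_real (2 * eta_d D j) * (data_res j a \<bullet>c (data_mat *\<^sub>v \<rho>))"
  unfolding cscalar_prod_mult_mat_vec[OF state_mat_carrier assms]
    cscalar_prod_mult_mat_vec[OF data_mat_carrier assms] cscalar_prod_sum[OF assms]
  by (simp add: grad_single_def sum_subtractf sum_distrib_left algebra_simps)

text \<open>Both residuals are affine in \<alpha>, so the expansion is exact. Unit vectors as \<rho>
  give the gradient, search directions give the line search.\<close>

lemma Fsom_single_add:
  assumes "j < incidences D" "a \<in> carrier_vec N" "m \<in> carrier_vec M" "\<rho> \<in> carrier_vec N"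
  shows "Fsom_single D j (a + t \<cdot>\<^sub>v \<rho>) m =
    Fsom_single D j a m + Re (cnj t * (grad_single j a m \<bullet>c \<rho>)) + (cmod t)\<^sup>2 * (curvature j m \<rho> / 2)"
proof -
  note mv = mult_mat_vec_carrier[OF state_mat_carrier assms(4)] mult_mat_vec_carrier[OF data_mat_carrier assms(4)]
  have "Fsom_single D j (a + t \<cdot>\<^sub>v \<rho>) m =
    eta_s D j * ((l2_norm (state_res j a m))\<^sup>2 +
      Re (cnj t * (2 * (state_res j a m \<bullet>c (state_mat m *\<^sub>v \<rho>)))) +
      (cmod t)\<^sup>2 * (l2_norm (state_mat m *\<^sub>v \<rho>))\<^sup>2) +
    eta_d D j * ((l2_norm (data_res j a))\<^sup>2 +
      Re (cnj (- t) * (2 * (data_res j a \<bullet>c (data_mat *\<^sub>v \<rho>)))) +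
      (cmod (- t))\<^sup>2 * (l2_norm (data_mat *\<^sub>v \<rho>))\<^sup>2)"
    unfolding Fsom_single_eq state_res_add[OF assms] data_res_add[OF assms(1,2,4)]
    by (simp only: l2_norm_add_smult_power2[OF state_res_carrier[OF assms(1-3)] mv(1)]
      l2_norm_add_smult_power2[OF data_res_carrier[OF assms(1,2)] mv(2)])
  then show ?thesis
    unfolding grad_single_cscalar_prod[OF assms(4)] Fsom_single_eq curvature_def
    by (simp add: algebra_simps)
qed

text \<open>Transfers the optimality of the step size to the gradient at the new point: along the
  line this inner product is affine in \<open>t\<close> with slope \<open>curvature\<close>.\<close>

lemma grad_single_add_cscalar_prod:
  assumes "j < incidences D" "a \<in> carrier_vec N" "m \<in> carrier_vec M" "\<rho> \<in> carrier_vec N"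
  shows "grad_single j (a + t \<cdot>\<^sub>v \<rho>) m \<bullet>c \<rho> =
    grad_single j a m \<bullet>c \<rho> + t * of_real (curvature j m \<rho>)"
proof -
  note mv = mult_mat_vec_carrier[OF state_mat_carrier assms(4)] mult_mat_vec_carrier[OF data_mat_carrier assms(4)]
  show ?thesis
    unfolding grad_single_cscalar_prod[OF assms(4)] state_res_add[OF assms] data_res_add[OF assms(1,2,4)]
      cscalar_prod_add_smult_left[OF state_res_carrier[OF assms(1-3)] mv(1) mv(1)]
      cscalar_prod_add_smult_left[OF data_res_carrier[OF assms(1,2)] mv(2) mv(2)]
      cscalar_prod_self curvature_def
    by (simp add: algebra_simps)
qed

lemma curvature_nonneg: "j < incidences D \<Longrightarrow> 0 \<le> curvature j m \<rho>"
  unfolding curvature_def using less_imp_le[OF eta_s_pos] less_imp_le[OF eta_d_pos]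
  by (intro add_nonneg_nonneg mult_nonneg_nonneg) auto

text \<open>Positive weights force both images of \<rho> to vanish, and the gradient sees \<rho>
  only through these images. This justifies the zero step taken when \<open>B = 0\<close>.\<close>

lemma grad_single_cscalar_prod_eq_0:
  assumes "j < incidences D" "\<rho> \<in> carrier_vec N" "curvature j m \<rho> = 0"
  shows "grad_single j a m \<bullet>c \<rho> = 0"
proof -
  note mv = mult_mat_vec_carrier[OF state_mat_carrier assms(2)] mult_mat_vec_carrier[OF data_mat_carrier assms(2)]
  have pos: "0 < eta_s D j" "0 < eta_d D j" using assms eta_s_pos eta_d_pos by auto
  have "2 * eta_s D j * (l2_norm (state_mat m *\<^sub>v \<rho>))\<^sup>2 = 0 \<and>
      2 * eta_d D j * (l2_norm (data_mat *\<^sub>v \<rho>))\<^sup>2 = 0"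
    using assms(3) pos unfolding curvature_def
    by (subst add_nonneg_eq_0_iff[symmetric]) (auto intro!: mult_nonneg_nonneg)
  then have "l2_norm (state_mat m *\<^sub>v \<rho>) = 0" "l2_norm (data_mat *\<^sub>v \<rho>) = 0" using pos by auto
  then have "\<And>i. i < M \<Longrightarrow> (state_mat m *\<^sub>v \<rho>) $ i = 0" "\<And>i. i < Q \<Longrightarrow> (data_mat *\<^sub>v \<rho>) $ i = 0"
    using l2_norm_eq_0_imp carrier_vecD[OF mv(1)] carrier_vecD[OF mv(2)] by metis+
  then show ?thesis
    unfolding grad_single_cscalar_prod[OF assms(2)] cscalar_prod_sum[OF mv(1)] cscalar_prod_sum[OF mv(2)]
    by simp
qed

lemma grad_alpha_eq:
  assumes "j < incidences D" "\<alpha> j \<in> carrier_vec N" "m \<in> carrier_vec M"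
  shows "grad_alpha D \<alpha> m j = grad_single j (\<alpha> j) m"
  unfolding grad_alpha_def
proof (rule complex_grad_eqI)
  have dim: "dim_vec (\<alpha> j) = N" using assms by simp
  show "grad_single j (\<alpha> j) m \<in> carrier_vec (dim_vec (\<alpha> j))"
    using grad_single_carrier dim by simp
  fix l t assume l: "l < dim_vec (\<alpha> j)"
  \<comment> \<open>Only the summand with index \<open>j\<close> changes; the rest is a constant of
    the expansion.\<close>
  have *: "Fsom D (\<alpha>(j := x)) m =
      Fsom_single D j x m + (\<Sum>i\<in>{..<incidences D} - {j}. Fsom_single D i (\<alpha> i) m)" for x
    unfolding Fsom_def using assms(1) by (subst sum.remove[of _ j]) auto
  show "Fsom D (\<alpha>(j := \<alpha> j + t \<cdot>\<^sub>v unit_vec (dim_vec (\<alpha> j)) l)) m =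
      Fsom D (\<alpha>(j := \<alpha> j)) m + Re (cnj t * grad_single j (\<alpha> j) m $ l) +
      (cmod t)\<^sup>2 * (curvature j m (unit_vec N l) / 2)"
    unfolding * dim Fsom_single_add[OF assms unit_vec_carrier]
    using cscalar_prod_unit_vec[of l N "grad_single j (\<alpha> j) m"] l dim by simp
qed

lemma state_res_index:
  assumes "j < incidences D" "a \<in> carrier_vec N" "m \<in> carrier_vec M" "l < M"
  shows "state_res j a m $ l = m $ l * total_field j a $ l - omega D j a $ l"
proof -
  have "omega D j a \<in> carrier_vec M" using assms omega_carrier by auto
  moreover from this have "Tvol D *\<^sub>v omega D j a \<in> carrier_vec M" using Tvol by auto
  ultimately show ?thesis
    unfolding state_res_def total_field_def using assms Tvol u_inc
    by (auto simp: index_hadamard dim_hadamard algebra_simps simp del: index_mult_mat_vec)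
qed

text \<open>The data residual does not involve \<open>m\<close>, and each entry of the state
  residual is affine in the same entry of \<open>m\<close> with slope the total field. Hence the
  objective separates over the entries, and all of them can be updated at once.\<close>

lemma Fsom_contrast_add:
  assumes \<alpha>: "\<And>j. j < incidences D \<Longrightarrow> \<alpha> j \<in> carrier_vec N"
    and m: "m \<in> carrier_vec M" and t: "t \<in> carrier_vec M"
  shows "Fsom D \<alpha> (m + t) = Fsom D \<alpha> m +
    (\<Sum>l<M. Re (cnj (t $ l) * grad_contrast \<alpha> m $ l) + (cmod (t $ l))\<^sup>2 * field_weight \<alpha> l)"
proof -
  let ?R = "\<lambda>j l. state_res j (\<alpha> j) m $ l" and ?U = "\<lambda>j l. total_field j (\<alpha> j) $ l"
  have single: "Fsom_single D j (\<alpha> j) (m + t) = Fsom_single D j (\<alpha> j) m +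
      (\<Sum>l<M. Re (cnj (t $ l) * (of_real (2 * eta_s D j) * (?R j l * cnj (?U j l)))) +
        (cmod (t $ l))\<^sup>2 * (eta_s D j * (cmod (?U j l))\<^sup>2))"
    if j: "j < incidences D" for j
  proof -
    have mt: "m + t \<in> carrier_vec M" using m t by simp
    have 1: "(l2_norm (state_res j (\<alpha> j) (m + t)))\<^sup>2 = (\<Sum>l<M. (cmod (?R j l + t $ l * ?U j l))\<^sup>2)"
      unfolding l2_norm_power2 using state_res_carrier[OF j \<alpha>[OF j] mt] m t
      by (auto intro!: sum.cong simp: state_res_index[OF j \<alpha>[OF j] mt]
          state_res_index[OF j \<alpha>[OF j] m] algebra_simps)
    have 2: "(l2_norm (state_res j (\<alpha> j) m))\<^sup>2 = (\<Sum>l<M. (cmod (?R j l))\<^sup>2)"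
      unfolding l2_norm_power2 using state_res_carrier[OF j \<alpha>[OF j] m] by auto
    have 3: "eta_s D j * (cmod (?R j l + t $ l * ?U j l))\<^sup>2 = eta_s D j * (cmod (?R j l))\<^sup>2 +
        (Re (cnj (t $ l) * (of_real (2 * eta_s D j) * (?R j l * cnj (?U j l)))) +
        (cmod (t $ l))\<^sup>2 * (eta_s D j * (cmod (?U j l))\<^sup>2))" for l
      unfolding cmod_add_mult_power2 by (simp add: algebra_simps)
    show ?thesis
      unfolding Fsom_single_eq 1 2 sum_distrib_left 3 sum.distrib by linarith
  qed
  have "Fsom D \<alpha> (m + t) = Fsom D \<alpha> m +
      (\<Sum>l<M. \<Sum>j<incidences D. Re (cnj (t $ l) * (of_real (2 * eta_s D j) * (?R j l * cnj (?U j l)))) +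
        (cmod (t $ l))\<^sup>2 * (eta_s D j * (cmod (?U j l))\<^sup>2))"
    unfolding Fsom_def using single by (subst sum.swap) (simp add: sum.distrib)
  also have "(\<Sum>l<M. \<Sum>j<incidences D. Re (cnj (t $ l) * (of_real (2 * eta_s D j) * (?R j l * cnj (?U j l)))) +
        (cmod (t $ l))\<^sup>2 * (eta_s D j * (cmod (?U j l))\<^sup>2)) =
     (\<Sum>l<M. Re (cnj (t $ l) * grad_contrast \<alpha> m $ l) + (cmod (t $ l))\<^sup>2 * field_weight \<alpha> l)"
    by (intro sum.cong refl)
      (simp only: sum.distrib grad_contrast_def field_weight_def sum_distrib_left Re_sum index_vec lessThan_iff)
  finally show ?thesis .
qed

lemma grad_m_eq:
  assumes \<alpha>: "\<And>j. j < incidences D \<Longrightarrow> \<alpha> j \<in> carrier_vec N" and m: "m \<in> carrier_vec M"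
  shows "grad_m D \<alpha> m = grad_contrast \<alpha> m"
  unfolding grad_m_def
proof (rule complex_grad_eqI)
  have dim: "dim_vec m = M" using m by simp
  show "grad_contrast \<alpha> m \<in> carrier_vec (dim_vec m)"
    using grad_contrast_carrier dim by simp
  fix l and t :: complex assume l: "l < dim_vec m"
  let ?t = "t \<cdot>\<^sub>v unit_vec M l"
  have "(\<Sum>i<M. Re (cnj (?t $ i) * grad_contrast \<alpha> m $ i) + (cmod (?t $ i))\<^sup>2 * field_weight \<alpha> i) =
      (\<Sum>i<M. if i = l then Re (cnj t * grad_contrast \<alpha> m $ i) + (cmod t)\<^sup>2 * field_weight \<alpha> i else 0)"
    using l dim by (intro sum.cong) auto
  also have "\<dots> = Re (cnj t * grad_contrast \<alpha> m $ l) + (cmod t)\<^sup>2 * field_weight \<alpha> l"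
    using l dim by simp
  finally show "Fsom D \<alpha> (m + t \<cdot>\<^sub>v unit_vec (dim_vec m) l) =
      Fsom D \<alpha> m + Re (cnj t * grad_contrast \<alpha> m $ l) + (cmod t)\<^sup>2 * field_weight \<alpha> l"
    unfolding dim using Fsom_contrast_add[OF \<alpha> m, where t = ?t] by simp
qed

section \<open>Continuity of residuals and gradients along convergent sequences\<close>

lemma vec_tendsto_omega:
  assumes "j < incidences D" "vec_tendsto N a a'"
  shows "vec_tendsto M (\<lambda>k. omega D j (a k)) (omega D j a')"
  unfolding omega_def
  by (rule vec_tendsto_add[OF vec_tendsto_const[OF omega_s[OF assms(1)]]
        vec_tendsto_mult_mat_vec[OF Vn assms(2)]])

lemma vec_tendsto_total_field:
  assumes "j < incidences D" "vec_tendsto N a a'"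
  shows "vec_tendsto M (\<lambda>k. total_field j (a k)) (total_field j a')"
  unfolding total_field_def
  by (rule vec_tendsto_add[OF vec_tendsto_const[OF u_inc[OF assms(1)]]
        vec_tendsto_mult_mat_vec[OF Tvol vec_tendsto_omega[OF assms]]])

lemma vec_tendsto_state_res:
  assumes "j < incidences D" "vec_tendsto N a a'" "vec_tendsto M m m'"
  shows "vec_tendsto M (\<lambda>k. state_res j (a k) (m k)) (state_res j a' m')"
  unfolding state_res_def
  by (intro vec_tendsto_add vec_tendsto_diff vec_tendsto_hadamard assms(3)
      vec_tendsto_const[OF u_inc[OF assms(1)]] vec_tendsto_omega[OF assms(1,2)]
      vec_tendsto_mult_mat_vec[OF Tvol vec_tendsto_omega[OF assms(1,2)]])

lemma vec_tendsto_data_res: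
  assumes "j < incidences D" "vec_tendsto N a a'"
  shows "vec_tendsto Q (\<lambda>k. data_res j (a k)) (data_res j a')"
  unfolding data_res_def
  by (intro vec_tendsto_diff vec_tendsto_const[OF u_inf[OF assms(1)]]
      vec_tendsto_const[OF mult_mat_vec_carrier[OF Tinf omega_s[OF assms(1)]]]
      vec_tendsto_mult_mat_vec[OF Tinf vec_tendsto_mult_mat_vec[OF Vn assms(2)]])

lemma vec_tendsto_state_mat_col:
  assumes "vec_tendsto M m m'" "l < N"
  shows "vec_tendsto M (\<lambda>k. col (state_mat (m k)) l) (col (state_mat m') l)"
  using assms unfolding vec_tendsto_def state_mat_def by (auto intro!: tendsto_intros)

lemma vec_tendsto_grad_single:
  assumes "j < incidences D" "vec_tendsto N a a'" "vec_tendsto M m m'"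
  shows "vec_tendsto N (\<lambda>k. grad_single j (a k) (m k)) (grad_single j a' m')"
  unfolding grad_single_def
proof (intro vec_tendsto_vec tendsto_diff tendsto_mult tendsto_const)
  fix l assume l: "l < N"
  show "(\<lambda>k. state_res j (a k) (m k) \<bullet>c col (state_mat (m k)) l) \<longlonglongrightarrow>
      state_res j a' m' \<bullet>c col (state_mat m') l"
    by (intro tendsto_cscalar_prod[of M] vec_tendsto_state_res vec_tendsto_state_mat_col assms l)
  show "(\<lambda>k. data_res j (a k) \<bullet>c col data_mat l) \<longlonglongrightarrow> data_res j a' \<bullet>c col data_mat l"
    using data_mat_carrier
    by (intro tendsto_cscalar_prod[of Q] vec_tendsto_data_res vec_tendsto_const assms) auto
qed

lemma vec_tendsto_grad_contrast:
  assumes "\<And>j. j < incidences D \<Longrightarrow> vec_tendsto N (\<lambda>k. \<alpha> k j) (\<alpha>' j)" "vec_tendsto M m m'"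
  shows "vec_tendsto M (\<lambda>k. grad_contrast (\<alpha> k) (m k)) (grad_contrast \<alpha>' m')"
  unfolding grad_contrast_def
proof (intro vec_tendsto_vec tendsto_sum tendsto_mult tendsto_const tendsto_cnj)
  fix l j assume "l < M" and "j \<in> {..<incidences D}"
  then show "(\<lambda>k. state_res j (\<alpha> k j) (m k) $ l) \<longlonglongrightarrow> state_res j (\<alpha>' j) m' $ l"
    and "(\<lambda>k. total_field j (\<alpha> k j) $ l) \<longlonglongrightarrow> total_field j (\<alpha>' j) $ l"
    using vec_tendsto_state_res[OF _ assms] vec_tendsto_total_field[OF _ assms(1)]
    unfolding vec_tendsto_def by auto
qed

end

section \<open>The iteration\<close>

lemma search_direction_carrier:
  assumes "g \<in> carrier_vec n" "\<rho> \<in> carrier_vec n"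
  shows "search_direction g g' \<rho> \<in> carrier_vec n"
  using assms by (simp add: search_direction_def)

lemma dim_grad_alpha: "dim_vec (grad_alpha D \<alpha> m j) = dim_vec (\<alpha> j)"
  by (simp add: grad_alpha_def complex_grad_def)

context som_problem
begin

section \<open>Descent and optimality of a single half step\<close>

lemma alpha_step_size_eq:
  assumes "m \<in> carrier_vec M" "\<rho> \<in> carrier_vec N"
  shows "alpha_step_size D \<gamma> j m g \<rho> =
    (if curvature j m \<rho> = 0 then 0
     else soft (\<gamma> * l1_norm \<rho> / curvature j m \<rho>) (- (g \<bullet>c \<rho>) / of_real (curvature j m \<rho>)))"
proof -
  have V: "Vn D *\<^sub>v \<rho> \<in> carrier_vec M" using Vn assms by auto
  have "l2_norm (state_mat m *\<^sub>v \<rho>) = l2_norm (Vn D *\<^sub>v \<rho> - m \<odot> (Tvol D *\<^sub>v (Vn D *\<^sub>v \<rho>)))"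
    unfolding state_mat_mult_vec[OF assms]
    by (rule l2_norm_minus_commute[OF hadamard_carrier[OF assms(1)] V])
  moreover have "data_mat *\<^sub>v \<rho> = Tinf D *\<^sub>v (Vn D *\<^sub>v \<rho>)"
    unfolding data_mat_def by (rule assoc_mult_mat_vec[OF Tinf Vn assms(2)])
  ultimately show ?thesis
    unfolding alpha_step_size_def curvature_def Let_def by simp
qed

text \<open>With \<open>q\<close> the inner product of gradient and direction, the penalised
  objective along \<rho> is, up to a constant, \<open>B\<close> times the soft thresholding problem
  with \<open>z = - q / B\<close> and threshold \<open>c / B\<close>. Then
  \<open>soft_descent\<close> gives the decrease and \<open>soft_diff_le\<close> the bound at the
  new point.\<close>

lemma alpha_step:
  assumes j: "j < incidences D" and a: "a \<in> carrier_vec N" and m: "m \<in> carrier_vec M"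
    and \<rho>: "\<rho> \<in> carrier_vec N" and \<gamma>: "0 < \<gamma>"
    and s: "s = alpha_step_size D \<gamma> j m (grad_single j a m) \<rho>"
  shows "Fsom_single D j (a + s \<cdot>\<^sub>v \<rho>) m + \<gamma> * l1_norm (s \<cdot>\<^sub>v \<rho>) \<le> Fsom_single D j a m"
    and "cmod (grad_single j (a + s \<cdot>\<^sub>v \<rho>) m \<bullet>c \<rho>) \<le> \<gamma> * l1_norm \<rho>"
proof -
  define B where "B = curvature j m \<rho>"
  define q where "q = grad_single j a m \<bullet>c \<rho>"
  define c where "c = \<gamma> * l1_norm \<rho>"
  have c: "0 \<le> c" unfolding c_def using \<gamma> by (simp add: l1_norm_nonneg)
  have s_eq: "s = (if B = 0 then 0 else soft (c / B) (- q / of_real B))"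
    unfolding s alpha_step_size_eq[OF m \<rho>] B_def q_def c_def ..
  have "Re (cnj s * q) + (cmod s)\<^sup>2 * (B / 2) + c * cmod s \<le> 0 \<and> cmod (q + s * of_real B) \<le> c"
  proof (cases "B = 0")
    \<comment> \<open>In this degenerate case the step is 0 by definition and \<open>q\<close>
      vanishes, so both claims are trivial.\<close>
    case True
    then have "q = 0" unfolding q_def B_def using grad_single_cscalar_prod_eq_0[OF j \<rho>] by simp
    then show ?thesis using True c s_eq by simp
  next
    case False
    then have B: "0 < B" using curvature_nonneg[OF j] unfolding B_def by (metis less_eq_real_def)
    define z where "z = - q / of_real B"
    have q: "q = - (of_real B * z)" unfolding z_def using B by simp
    have s: "s = soft (c / B) z" unfolding z_def s_eq using B by simp
    have cB: "0 \<le> c / B" using c B by simp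
    have "B * ((cmod s)\<^sup>2 / 2 - Re (cnj s * z) + c / B * cmod s) \<le> 0"
      unfolding s using B soft_descent[OF cB, of z] by (intro mult_nonneg_nonpos) auto
    moreover have "Re (cnj s * q) = - B * Re (cnj s * z)"
      unfolding q by (simp add: algebra_simps)
    moreover have "q + s * of_real B = of_real B * (s - z)" unfolding q by (simp add: algebra_simps)
    then have "cmod (q + s * of_real B) = B * cmod (s - z)" using B by (simp add: norm_mult)
    moreover have "B * cmod (s - z) \<le> B * (c / B)"
      unfolding s using soft_diff_le[OF cB, of z] B by (intro mult_left_mono) auto
    ultimately show ?thesis using B by (simp add: algebra_simps)
  qed
  then show "Fsom_single D j (a + s \<cdot>\<^sub>v \<rho>) m + \<gamma> * l1_norm (s \<cdot>\<^sub>v \<rho>) \<le> Fsom_single D j a m"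
    and "cmod (grad_single j (a + s \<cdot>\<^sub>v \<rho>) m \<bullet>c \<rho>) \<le> \<gamma> * l1_norm \<rho>"
    unfolding Fsom_single_add[OF j a m \<rho>] grad_single_add_cscalar_prod[OF j a m \<rho>]
      l1_norm_smult B_def[symmetric] q_def[symmetric] c_def[symmetric]
    by (simp_all add: c_def algebra_simps)
qed

lemma m_update_carrier: "m \<in> carrier_vec M \<Longrightarrow> m_update D \<beta> \<alpha> m \<in> carrier_vec M"
  by (auto simp: m_update_def Let_def)

text \<open>Isolates the dependence on \<open>m\<close>: where the weight is nonzero, the entry
  vanishes exactly at the weighted least squares value that the contrast update thresholds
  towards.\<close>

lemma grad_contrast_index:
  assumes "\<And>j. j < incidences D \<Longrightarrow> \<alpha> j \<in> carrier_vec N" "m \<in> carrier_vec M" "l < M"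
  shows "grad_contrast \<alpha> m $ l = 2 * (of_real (field_weight \<alpha> l) * m $ l -
    (\<Sum>j<incidences D. of_real (eta_s D j) * cnj (total_field j (\<alpha> j) $ l) * omega D j (\<alpha> j) $ l))"
proof -
  have "of_real (2 * eta_s D j) * (state_res j (\<alpha> j) m $ l * cnj (total_field j (\<alpha> j) $ l)) =
      2 * (of_real (eta_s D j * (cmod (total_field j (\<alpha> j) $ l))\<^sup>2) * m $ l -
        of_real (eta_s D j) * cnj (total_field j (\<alpha> j) $ l) * omega D j (\<alpha> j) $ l)"
    if "j < incidences D" for j
    unfolding state_res_index[OF that assms(1)[OF that] assms(2,3)] of_real_mult complex_norm_square
    by (simp add: algebra_simps)
  then show ?thesis
    unfolding grad_contrast_def field_weight_def using assms(3)
    by (simp add: sum_subtractf sum_distrib_left sum_distrib_right right_diff_distrib)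
qed

lemma field_weight_nonneg: "0 \<le> field_weight \<alpha> l"
  unfolding field_weight_def using less_imp_le[OF eta_s_pos] by (intro sum_nonneg) auto

text \<open>The algorithm branches on the vanishing of all fields, the proof on the vanishing of the
  weight; positivity of \<open>eta_s\<close> makes the two cases agree.\<close>

lemma field_weight_eq_0_iff:
  "field_weight \<alpha> l = 0 \<longleftrightarrow> (\<forall>j<incidences D. total_field j (\<alpha> j) $ l = 0)"
proof -
  have "field_weight \<alpha> l = 0 \<longleftrightarrow>
      (\<forall>j\<in>{..<incidences D}. eta_s D j * (cmod (total_field j (\<alpha> j) $ l))\<^sup>2 = 0)"
    unfolding field_weight_def using less_imp_le[OF eta_s_pos]
    by (intro sum_nonneg_eq_0_iff) auto
  moreover have "eta_s D j \<noteq> 0" if "j < incidences D" for j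
    using eta_s_pos[OF that] by simp
  ultimately show ?thesis by auto
qed

text \<open>By separability this is a scalar soft thresholding problem for each entry. The second
  bound concerns the gradient at the updated contrast, with the same \<alpha>, and so survives in
  the limit.\<close>

lemma contrast_step:
  assumes \<alpha>: "\<And>j. j < incidences D \<Longrightarrow> \<alpha> j \<in> carrier_vec N" and m: "m \<in> carrier_vec M"
    and \<beta>: "0 < \<beta>" and m': "m' = m_update D \<beta> \<alpha> m"
  shows "Fsom D \<alpha> m' + \<beta> * l1_norm (m' - m) \<le> Fsom D \<alpha> m"
    and "\<And>l. l < M \<Longrightarrow> cmod (grad_contrast \<alpha> m' $ l) \<le> \<beta>"
proof -
  have m'M: "m' \<in> carrier_vec M" using m_update_carrier[OF m] m' by simp
  define t where "t = m' - m"
  have t: "t \<in> carrier_vec M" and m't: "m' = m + t"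
    unfolding t_def using m m'M by auto
  have main: "Re (cnj (t $ l) * grad_contrast \<alpha> m $ l) + (cmod (t $ l))\<^sup>2 * field_weight \<alpha> l
        + \<beta> * cmod (t $ l) \<le> 0 \<and> cmod (grad_contrast \<alpha> m' $ l) \<le> \<beta>"
    if l: "l < M" for l
  proof -
    define A where "A = field_weight \<alpha> l"
    define w where "w = (\<Sum>j<incidences D. of_real (eta_s D j) * cnj (total_field j (\<alpha> j) $ l) * omega D j (\<alpha> j) $ l)"
    have g: "grad_contrast \<alpha> x $ l = 2 * (of_real A * x $ l - w)" if "x \<in> carrier_vec M" for x
      unfolding A_def w_def by (rule grad_contrast_index[OF \<alpha> that l])
    have "m' $ l = (if \<forall>j<incidences D. total_field j (\<alpha> j) $ l = 0 then m $ l
        else m $ l + soft (\<beta> / (2 * A)) (w / of_real A - m $ l))"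
      using m l unfolding m' m_update_def Let_def A_def w_def
      by (auto simp: total_field_def field_weight_def)
    then have m'l: "m' $ l = (if A = 0 then m $ l else m $ l + soft (\<beta> / (2 * A)) (w / of_real A - m $ l))"
      unfolding A_def field_weight_eq_0_iff .
    have tl: "t $ l = m' $ l - m $ l" unfolding t_def using m l by simp
    show ?thesis
    proof (cases "A = 0")
      \<comment> \<open>Where all fields vanish, \<open>w\<close> vanishes too, so this gradient
        entry is 0 for every contrast and keeping the old value is harmless.\<close>
      case True
      then have "\<forall>j<incidences D. total_field j (\<alpha> j) $ l = 0"
        unfolding A_def field_weight_eq_0_iff .
      then have "w = 0" unfolding w_def by simp
      then show ?thesis using True m'l tl g[OF m'M] \<beta> by simp
    next
      case False
      then have A: "0 < A" using field_weight_nonneg unfolding A_def by (metis less_eq_real_def)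
      define z where "z = w / of_real A - m $ l"
      have s: "t $ l = soft (\<beta> / (2 * A)) z" unfolding tl m'l z_def using A by simp
      have w: "w = of_real A * (z + m $ l)" unfolding z_def using A by simp
      have \<tau>: "0 \<le> \<beta> / (2 * A)" using \<beta> A by simp
      \<comment> \<open>The gradient entry at a contrast value \<open>x\<close> is
        \<open>2 * A * (x - w / A)\<close>, so the scalar problem is rescaled by
        \<open>2 * A\<close>; this matches the threshold \<open>\<beta> / (2 * A)\<close>.\<close>
      have "2 * A * ((cmod (t $ l))\<^sup>2 / 2 - Re (cnj (t $ l) * z) + \<beta> / (2 * A) * cmod (t $ l)) \<le> 0"
        unfolding s using A soft_descent[OF \<tau>, of z] by (intro mult_nonneg_nonpos) auto
      moreover have "Re (cnj (t $ l) * grad_contrast \<alpha> m $ l) = - 2 * A * Re (cnj (t $ l) * z)"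
        unfolding g[OF m] w by (simp add: algebra_simps)
      moreover have "grad_contrast \<alpha> m' $ l = of_real (2 * A) * (t $ l - z)"
        unfolding g[OF m'M] w tl by (simp add: algebra_simps)
      then have "cmod (grad_contrast \<alpha> m' $ l) = 2 * A * cmod (t $ l - z)"
        using A by (simp add: norm_mult)
      moreover have "2 * A * cmod (t $ l - z) \<le> 2 * A * (\<beta> / (2 * A))"
        unfolding s using soft_diff_le[OF \<tau>, of z] A by (intro mult_left_mono) auto
      ultimately show ?thesis using A unfolding A_def[symmetric] by (simp add: algebra_simps)
    qed
  qed
  show "cmod (grad_contrast \<alpha> m' $ l) \<le> \<beta>" if "l < M" for l
    using main[OF that] by simp
  have "(\<Sum>l<M. Re (cnj (t $ l) * grad_contrast \<alpha> m $ l) + (cmod (t $ l))\<^sup>2 * field_weight \<alpha> l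
        + \<beta> * cmod (t $ l)) \<le> 0"
    using main by (intro sum_nonpos) auto
  moreover have "\<beta> * l1_norm t = (\<Sum>l<M. \<beta> * cmod (t $ l))"
    using t by (simp add: l1_norm_def sum_distrib_left)
  moreover have "Fsom D \<alpha> m' = Fsom D \<alpha> m +
      (\<Sum>l<M. Re (cnj (t $ l) * grad_contrast \<alpha> m $ l) + (cmod (t $ l))\<^sup>2 * field_weight \<alpha> l)"
    unfolding m't by (intro Fsom_contrast_add \<alpha> m t)
  ultimately show "Fsom D \<alpha> m' + \<beta> * l1_norm (m' - m) \<le> Fsom D \<alpha> m"
    unfolding t_def[symmetric] sum.distrib by linarith
qed

end

section \<open>Summable steps and convergence of the iterates\<close>

locale som_iteration = som_problem +
  fixes \<gamma> \<beta> :: real and m0 :: "complex vec"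
  assumes \<gamma>_pos: "0 < \<gamma>" and \<beta>_pos: "0 < \<beta>" and m0: "m0 \<in> carrier_vec M"
begin

abbreviation iter :: "nat \<Rightarrow> irsom_state" where
  "iter \<equiv> irsom D \<gamma> \<beta> m0"

lemma alpha_of_Suc:
  "alpha_of (iter (Suc k)) j = alpha_of (iter k) j +
    alpha_step_size D \<gamma> j (m_of (iter k)) (g_of (iter k) j) (rho_of (iter k) j) \<cdot>\<^sub>v rho_of (iter k) j"
  by (simp add: Let_def)

lemma m_of_Suc: "m_of (iter (Suc k)) = m_update D \<beta> (alpha_of (iter (Suc k))) (m_of (iter k))"
  by (simp add: Let_def)

lemma rho_of_Suc:
  "rho_of (iter (Suc k)) j = search_direction (g_of (iter (Suc k)) j) (g_of (iter k) j) (rho_of (iter k) j)"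
  by (simp add: Let_def)

lemma g_of_iter: "g_of (iter k) = grad_alpha D (alpha_of (iter k)) (m_of (iter k))"
  by (cases k) (simp_all add: Let_def)

text \<open>Stated for every \<open>j\<close>, since the recursion also updates indices outside the
  range of incidences; a gradient inherits its dimension from the block it is taken at.\<close>

lemma iter_carrier:
  "alpha_of (iter k) j \<in> carrier_vec N \<and> m_of (iter k) \<in> carrier_vec M \<and>
    g_of (iter k) j \<in> carrier_vec N \<and> rho_of (iter k) j \<in> carrier_vec N"
proof (induction k)
  case 0
  have "alpha_of (iter 0) j \<in> carrier_vec N" using Vn by (simp add: Let_def)
  moreover from this have "g_of (iter 0) j \<in> carrier_vec N"
    unfolding g_of_iter using dim_grad_alpha by (metis carrier_vec_dim_vec carrier_vecD)
  moreover have "rho_of (iter 0) j = g_of (iter 0) j" by (simp add: Let_def)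
  ultimately show ?case using m0 by (simp add: Let_def)
next
  case (Suc k)
  have 1: "alpha_of (iter (Suc k)) j \<in> carrier_vec N" unfolding alpha_of_Suc using Suc by simp
  then have 2: "g_of (iter (Suc k)) j \<in> carrier_vec N"
    unfolding g_of_iter using dim_grad_alpha by (metis carrier_vec_dim_vec carrier_vecD)
  have 3: "rho_of (iter (Suc k)) j \<in> carrier_vec N"
    unfolding rho_of_Suc using 2 Suc by (intro search_direction_carrier) auto
  have 4: "m_of (iter (Suc k)) \<in> carrier_vec M"
    unfolding m_of_Suc using Suc by (intro m_update_carrier) auto
  show ?case using 1 2 3 4 by simp
qed

lemmas alpha_carrier = iter_carrier[THEN conjunct1]
  and m_carrier = iter_carrier[THEN conjunct2, THEN conjunct1]
  and rho_carrier = iter_carrier[THEN conjunct2, THEN conjunct2, THEN conjunct2]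

lemma g_of_eq:
  "j < incidences D \<Longrightarrow> g_of (iter k) j = grad_single j (alpha_of (iter k) j) (m_of (iter k))"
  unfolding g_of_iter by (rule grad_alpha_eq[OF _ alpha_carrier m_carrier])

lemma alpha_diff:
  "alpha_of (iter (Suc k)) j - alpha_of (iter k) j =
    alpha_step_size D \<gamma> j (m_of (iter k)) (g_of (iter k) j) (rho_of (iter k) j) \<cdot>\<^sub>v rho_of (iter k) j"
  unfolding alpha_of_Suc using alpha_carrier[of k j] rho_carrier[of k j]
  by (intro eq_vecI) auto

lemma iter_alpha_step:
  assumes "j < incidences D"
  shows "Fsom_single D j (alpha_of (iter (Suc k)) j) (m_of (iter k)) +
      \<gamma> * l1_norm (alpha_of (iter (Suc k)) j - alpha_of (iter k) j) \<le>
      Fsom_single D j (alpha_of (iter k) j) (m_of (iter k))"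
    and "cmod (grad_single j (alpha_of (iter (Suc k)) j) (m_of (iter k)) \<bullet>c rho_of (iter k) j) \<le>
      \<gamma> * l1_norm (rho_of (iter k) j)"
  unfolding alpha_diff
  using alpha_step[OF assms alpha_carrier m_carrier rho_carrier \<gamma>_pos refl] 
  unfolding alpha_of_Suc g_of_eq[OF assms] by auto

lemma iter_contrast_step:
  shows "Fsom D (alpha_of (iter (Suc k))) (m_of (iter (Suc k))) +
      \<beta> * l1_norm (m_of (iter (Suc k)) - m_of (iter k)) \<le> Fsom D (alpha_of (iter (Suc k))) (m_of (iter k))"
    and "l < M \<Longrightarrow> cmod (grad_contrast (alpha_of (iter (Suc k))) (m_of (iter (Suc k))) $ l) \<le> \<beta>"
  using contrast_step[OF alpha_carrier m_carrier \<beta>_pos m_of_Suc] by auto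

text \<open>The decrease of the objective guaranteed by one full iteration, namely the two penalties
  actually paid.\<close>

definition progress :: "nat \<Rightarrow> real" where
  "progress k = \<gamma> * (\<Sum>j<incidences D. l1_norm (alpha_of (iter (Suc k)) j - alpha_of (iter k) j)) +
     \<beta> * l1_norm (m_of (iter (Suc k)) - m_of (iter k))"

text \<open>For fixed \<open>m\<close> the objective is a sum of independent terms, one per block of
  \<alpha>, so the decreases of the parallel line searches add up. The contrast step then starts
  from the value they reached.\<close>

lemma summable_progress: "summable progress"
proof (rule summable_of_descent)
  fix k
  show "0 \<le> Fsom D (alpha_of (iter k)) (m_of (iter k))" by (rule Fsom_nonneg)
  show "0 \<le> progress k"
    unfolding progress_def using \<gamma>_pos \<beta>_pos l1_norm_nonneg
    by (intro add_nonneg_nonneg mult_nonneg_nonneg sum_nonneg) auto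
  have "Fsom D (alpha_of (iter (Suc k))) (m_of (iter k)) +
      \<gamma> * (\<Sum>j<incidences D. l1_norm (alpha_of (iter (Suc k)) j - alpha_of (iter k) j)) \<le>
      Fsom D (alpha_of (iter k)) (m_of (iter k))"
    unfolding Fsom_def sum_distrib_left sum.distrib[symmetric]
    using iter_alpha_step(1) by (intro sum_mono) auto
  then show "Fsom D (alpha_of (iter (Suc k))) (m_of (iter (Suc k))) + progress k \<le>
      Fsom D (alpha_of (iter k)) (m_of (iter k))"
    unfolding progress_def using iter_contrast_step(1)[of k] by linarith
qed

lemma convergent_m:
  assumes "i < M"
  shows "convergent (\<lambda>k. m_of (iter k) $ i)"
proof (rule convergent_of_summable_increments)
  show "summable (\<lambda>k. progress k / \<beta>)" using summable_progress by (rule summable_divide)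
  fix k
  have "norm (m_of (iter (Suc k)) $ i - m_of (iter k) $ i) \<le> l1_norm (m_of (iter (Suc k)) - m_of (iter k))"
    using norm_le_l1_norm[of i "m_of (iter (Suc k)) - m_of (iter k)"] m_carrier[of k] m_carrier[of "Suc k"] assms
    by (simp del: irsom.simps)
  moreover have "0 \<le> \<gamma> * (\<Sum>j<incidences D. l1_norm (alpha_of (iter (Suc k)) j - alpha_of (iter k) j))"
    using \<gamma>_pos l1_norm_nonneg by (intro mult_nonneg_nonneg sum_nonneg) auto
  then have "l1_norm (m_of (iter (Suc k)) - m_of (iter k)) \<le> progress k / \<beta>"
    unfolding progress_def using \<beta>_pos by (simp add: field_simps del: irsom.simps)
  ultimately show "norm (m_of (iter (Suc k)) $ i - m_of (iter k) $ i) \<le> progress k / \<beta>" by linarith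
qed

lemma convergent_alpha:
  assumes "j < incidences D" "i < N"
  shows "convergent (\<lambda>k. alpha_of (iter k) j $ i)"
proof (rule convergent_of_summable_increments)
  show "summable (\<lambda>k. progress k / \<gamma>)" using summable_progress by (rule summable_divide)
  fix k
  let ?d = "\<lambda>j. l1_norm (alpha_of (iter (Suc k)) j - alpha_of (iter k) j)"
  have "norm (alpha_of (iter (Suc k)) j $ i - alpha_of (iter k) j $ i) \<le> ?d j"
    using norm_le_l1_norm[of i "alpha_of (iter (Suc k)) j - alpha_of (iter k) j"]
      alpha_carrier[of k j] alpha_carrier[of "Suc k" j] assms
    by (simp del: irsom.simps)
  also have "\<dots> \<le> (\<Sum>j<incidences D. ?d j)"
    using assms l1_norm_nonneg by (intro member_le_sum) auto
  also have "\<dots> \<le> progress k / \<gamma>"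
  proof -
    have "0 \<le> \<beta> * l1_norm (m_of (iter (Suc k)) - m_of (iter k))"
      using \<beta>_pos l1_norm_nonneg by (intro mult_nonneg_nonneg) auto
    then show ?thesis
      unfolding progress_def using \<gamma>_pos by (simp add: field_simps del: irsom.simps)
  qed
  finally show "norm (alpha_of (iter (Suc k)) j $ i - alpha_of (iter k) j $ i) \<le> progress k / \<gamma>" .
qed

text \<open>Bridges the norm convergence of the theorem and the entrywise convergence used in the
  proofs: the squared distance of the stacks is the sum of the squared distances of the
  blocks.\<close>

lemma iterates_tendsto_iff:
  "iterates_tendsto D iter \<alpha>' m' \<longleftrightarrow>
    (\<forall>j<incidences D. vec_tendsto N (\<lambda>k. alpha_of (iter k) j) (\<alpha>' j)) \<and>
    vec_tendsto M (\<lambda>k. m_of (iter k)) m'" (is "?L \<longleftrightarrow> ?R")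
proof -
  let ?d = "\<lambda>k. l2_norm (stack (incidences D) (alpha_of (iter k)) (m_of (iter k)) - stack (incidences D) \<alpha>' m')"
  have power2: "(?d k)\<^sup>2 = (\<Sum>j<incidences D. (l2_norm (alpha_of (iter k) j - \<alpha>' j))\<^sup>2) +
      (l2_norm (m_of (iter k) - m'))\<^sup>2"
    if "\<And>j. j < incidences D \<Longrightarrow> \<alpha>' j \<in> carrier_vec N" "m' \<in> carrier_vec M" for k
    using that alpha_carrier by (intro l2_norm_stack_diff_power2[where n = N and M = M] m_carrier) auto
  show ?thesis
  proof
    assume L: ?L
    then have \<alpha>': "\<And>j. j < incidences D \<Longrightarrow> \<alpha>' j \<in> carrier_vec N" and m': "m' \<in> carrier_vec M"
      and lim: "?d \<longlonglongrightarrow> 0"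
      using Vn unfolding iterates_tendsto_def by auto
    have "l2_norm (m_of (iter k) - m') \<le> ?d k" for k
      by (rule power2_le_imp_le[OF _ l2_norm_nonneg]) (simp add: power2[OF \<alpha>' m'] sum_nonneg)
    then have "(\<lambda>k. l2_norm (m_of (iter k) - m')) \<longlonglongrightarrow> 0"
      by (intro tendsto_sandwich[OF _ _ tendsto_const lim]) (auto simp: l2_norm_nonneg)
    then have "vec_tendsto M (\<lambda>k. m_of (iter k)) m'" by (rule vec_tendstoI_l2_norm[OF _ m' m_carrier])
    moreover have "vec_tendsto N (\<lambda>k. alpha_of (iter k) j) (\<alpha>' j)" if j: "j < incidences D" for j
    proof -
      have "(l2_norm (alpha_of (iter k) j - \<alpha>' j))\<^sup>2 \<le>
          (\<Sum>j<incidences D. (l2_norm (alpha_of (iter k) j - \<alpha>' j))\<^sup>2)" for k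
        using j by (intro member_le_sum) auto
      then have "l2_norm (alpha_of (iter k) j - \<alpha>' j) \<le> ?d k" for k
        by (intro power2_le_imp_le[OF _ l2_norm_nonneg])
          (auto simp: power2[OF \<alpha>' m'] intro!: add_increasing2)
      then have "(\<lambda>k. l2_norm (alpha_of (iter k) j - \<alpha>' j)) \<longlonglongrightarrow> 0"
        by (intro tendsto_sandwich[OF _ _ tendsto_const lim]) (auto simp: l2_norm_nonneg)
      then show ?thesis by (rule vec_tendstoI_l2_norm[OF _ \<alpha>'[OF j] alpha_carrier])
    qed
    ultimately show ?R by simp
  next
    assume R: ?R
    then have \<alpha>': "\<And>j. j < incidences D \<Longrightarrow> \<alpha>' j \<in> carrier_vec N" and m': "m' \<in> carrier_vec M"
      unfolding vec_tendsto_def by auto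
    have diff0: "(\<lambda>k. (l2_norm (x k - y))\<^sup>2) \<longlonglongrightarrow> 0" if "vec_tendsto n x y" for n x y
    proof -
      have y: "y \<in> carrier_vec n" using that unfolding vec_tendsto_def by simp
      have "(\<lambda>k. (l2_norm (x k - y))\<^sup>2) \<longlonglongrightarrow> (l2_norm (y - y))\<^sup>2"
        using that y by (intro tendsto_power tendsto_l2_norm vec_tendsto_diff vec_tendsto_const)
      then show ?thesis using y by (simp add: l2_norm_def)
    qed
    have *: "(?d k)\<^sup>2 = (\<Sum>j<incidences D. (l2_norm (alpha_of (iter k) j - \<alpha>' j))\<^sup>2) +
        (l2_norm (m_of (iter k) - m'))\<^sup>2" for k
      by (intro power2 \<alpha>' m')
    have "(\<lambda>k. (?d k)\<^sup>2) \<longlonglongrightarrow> (\<Sum>j<incidences D. 0) + 0"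
      unfolding * using R by (intro tendsto_add tendsto_sum diff0) auto
    from tendsto_real_sqrt[OF this] have "?d \<longlonglongrightarrow> 0"
      by (simp add: abs_of_nonneg l2_norm_nonneg)
    then show ?L using \<alpha>' m' Vn unfolding iterates_tendsto_def by auto
  qed
qed

lemma ex_iterates_tendsto: "\<exists>\<alpha>' m'. iterates_tendsto D iter \<alpha>' m'"
proof -
  define \<alpha>' where "\<alpha>' = (\<lambda>j. vec N (\<lambda>i. lim (\<lambda>k. alpha_of (iter k) j $ i)))"
  define m' where "m' = vec M (\<lambda>i. lim (\<lambda>k. m_of (iter k) $ i))"
  have "vec_tendsto N (\<lambda>k. alpha_of (iter k) j) (\<alpha>' j)" if "j < incidences D" for j
    unfolding vec_tendsto_def \<alpha>'_def
    using convergent_alpha[OF that] alpha_carrier by (auto simp: convergent_LIMSEQ_iff)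
  moreover have "vec_tendsto M (\<lambda>k. m_of (iter k)) m'"
    unfolding vec_tendsto_def m'_def
    using convergent_m m_carrier by (auto simp: convergent_LIMSEQ_iff)
  ultimately show ?thesis unfolding iterates_tendsto_iff by blast
qed

text \<open>At a nonstationary limit the Polak-Ribiere coefficients tend to 0.\<close>

lemma vec_tendsto_rho:
  assumes j: "j < incidences D" and g: "vec_tendsto N (\<lambda>k. g_of (iter k) j) g" and nz: "l2_norm g \<noteq> 0"
  shows "vec_tendsto N (\<lambda>k. rho_of (iter k) j) g"
proof -
  define c where "c k = Re (g_of (iter (Suc k)) j \<bullet>c (g_of (iter (Suc k)) j - g_of (iter k) j)) /
    (l2_norm (g_of (iter k) j))\<^sup>2" for k
  have gN: "g \<in> carrier_vec N" using g unfolding vec_tendsto_def by simp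
  have "c \<longlonglongrightarrow> Re (g \<bullet>c (g - g)) / (l2_norm g)\<^sup>2"
    unfolding c_def
    by (intro tendsto_divide tendsto_Re tendsto_power tendsto_cscalar_prod[of N] tendsto_l2_norm[of N]
        vec_tendsto_diff g vec_tendsto_Suc[OF g]) (use nz in simp)
  moreover have "g \<bullet>c (g - g) = 0"
    using gN by (subst cscalar_prod_sum[of _ N]) auto
  ultimately have c: "c \<longlonglongrightarrow> 0" by simp
  \<comment> \<open>The gradient norms tend to a nonzero number, so the restart branch of
    \<open>search_direction\<close> is taken only finitely often.\<close>
  have "eventually (\<lambda>k. l2_norm (g_of (iter k) j) \<noteq> 0) sequentially"
    using tendsto_l2_norm[OF g] nz by (rule tendsto_imp_eventually_ne)
  then have ev: "eventually (\<lambda>k. rho_of (iter (Suc k)) j =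
      g_of (iter (Suc k)) j + of_real (c k) \<cdot>\<^sub>v rho_of (iter k) j) sequentially"
  proof eventually_elim
    case (elim k)
    then have "g_of (iter k) j \<noteq> 0\<^sub>v (dim_vec (g_of (iter k) j))"
      by (auto simp: l2_norm_def dest!: arg_cong[of _ _ l2_norm])
    then show ?case unfolding rho_of_Suc search_direction_def c_def by simp
  qed
  show ?thesis
    unfolding vec_tendsto_def
  proof (intro conjI allI impI gN rho_carrier)
    fix i assume i: "i < N"
    show "(\<lambda>k. rho_of (iter k) j $ i) \<longlonglongrightarrow> g $ i"
    proof (rule tendsto_contracting_recursion)
      show "eventually (\<lambda>k. rho_of (iter (Suc k)) j $ i =
          g_of (iter (Suc k)) j $ i + of_real (c k) * rho_of (iter k) j $ i) sequentially"
        using ev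
      proof eventually_elim
        case (elim k)
        show ?case unfolding elim using i rho_carrier[of k j] by (simp del: irsom.simps)
      qed
      show "(\<lambda>k. g_of (iter (Suc k)) j $ i) \<longlonglongrightarrow> g $ i"
        using vec_tendsto_Suc[OF g] i unfolding vec_tendsto_def by simp
      show "(\<lambda>k. complex_of_real (c k)) \<longlonglongrightarrow> 0" using tendsto_of_real[OF c] by simp
    qed
  qed
qed

section \<open>Stationarity of the limit point\<close>

lemma limit_grad_single_le:
  assumes j: "j < incidences D" and lim: "iterates_tendsto D iter \<alpha>' m'"
    and L: "0 \<le> L" "\<And>\<xi>. \<xi> \<in> carrier_vec N \<Longrightarrow> l1_norm (\<xi> :: complex vec) \<le> L * l2_norm \<xi>"
  shows "l2_norm (grad_single j (\<alpha>' j) m') \<le> \<gamma> * L"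
\<comment> \<open>A vanishing limit gradient is separated off because the convergence of the search
  directions relies on it being nonzero; the bound is then trivial.\<close>
proof (cases "l2_norm (grad_single j (\<alpha>' j) m') = 0")
  case True
  then show ?thesis using L \<gamma>_pos by simp
next
  case False
  define g where "g = grad_single j (\<alpha>' j) m'"
  have a: "vec_tendsto N (\<lambda>k. alpha_of (iter k) j) (\<alpha>' j)" and m: "vec_tendsto M (\<lambda>k. m_of (iter k)) m'"
    using lim j unfolding iterates_tendsto_iff by auto
  have "vec_tendsto N (\<lambda>k. g_of (iter k) j) g"
    unfolding g_of_eq[OF j] g_def by (rule vec_tendsto_grad_single[OF j a m])
  then have \<rho>: "vec_tendsto N (\<lambda>k. rho_of (iter k) j) g"
    using False unfolding g_def by (rule vec_tendsto_rho[OF j])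
  \<comment> \<open>The line search bound holds at the new \<alpha> with the old \<open>m\<close>.
    Both arguments have the same limits as the full iterates, so this gradient also tends to
    \<open>g\<close>, as do the directions, and the inner product tends to the squared norm of
    \<open>g\<close>.\<close>
  have "vec_tendsto N (\<lambda>k. grad_single j (alpha_of (iter (Suc k)) j) (m_of (iter k))) g"
    unfolding g_def by (rule vec_tendsto_grad_single[OF j vec_tendsto_Suc[OF a] m])
  from tendsto_norm[OF tendsto_cscalar_prod[OF this \<rho>]]
  have 1: "(\<lambda>k. cmod (grad_single j (alpha_of (iter (Suc k)) j) (m_of (iter k)) \<bullet>c rho_of (iter k) j))
      \<longlonglongrightarrow> (l2_norm g)\<^sup>2"
    unfolding cscalar_prod_self norm_of_real abs_power2 .
  have 2: "(\<lambda>k. \<gamma> * (L * l2_norm (rho_of (iter k) j))) \<longlonglongrightarrow> \<gamma> * (L * l2_norm g)"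
    by (intro tendsto_intros tendsto_l2_norm[OF \<rho>])
  have "(l2_norm g)\<^sup>2 \<le> \<gamma> * (L * l2_norm g)"
  proof (rule LIMSEQ_le[OF 1 2], intro exI allI impI)
    fix k
    have "\<gamma> * l1_norm (rho_of (iter k) j) \<le> \<gamma> * (L * l2_norm (rho_of (iter k) j))"
      using L(2)[OF rho_carrier] \<gamma>_pos by (intro mult_left_mono) auto
    then show "cmod (grad_single j (alpha_of (iter (Suc k)) j) (m_of (iter k)) \<bullet>c rho_of (iter k) j)
        \<le> \<gamma> * (L * l2_norm (rho_of (iter k) j))"
      using iter_alpha_step(2)[OF j, of k] by linarith
  qed
  moreover have "0 < l2_norm g" using False l2_norm_nonneg unfolding g_def by (metis less_eq_real_def)
  ultimately show ?thesis unfolding g_def[symmetric] by (simp add: power2_eq_square)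
qed

lemma limit_grad_contrast_le:
  assumes lim: "iterates_tendsto D iter \<alpha>' m'" and l: "l < M"
  shows "cmod (grad_contrast \<alpha>' m' $ l) \<le> \<beta>"
proof -
  have "vec_tendsto M (\<lambda>k. grad_contrast (alpha_of (iter (Suc k))) (m_of (iter (Suc k)))) (grad_contrast \<alpha>' m')"
    using lim unfolding iterates_tendsto_iff by (intro vec_tendsto_grad_contrast vec_tendsto_Suc) auto
  then have "(\<lambda>k. cmod (grad_contrast (alpha_of (iter (Suc k))) (m_of (iter (Suc k))) $ l))
      \<longlonglongrightarrow> cmod (grad_contrast \<alpha>' m' $ l)"
    using l unfolding vec_tendsto_def by (intro tendsto_norm) auto
  then show ?thesis
    by (rule LIMSEQ_le_const2) (use iter_contrast_step(2)[OF l] in auto)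
qed

lemma limit_stationary:
  assumes lim: "iterates_tendsto D iter \<alpha>' m'"
    and L: "0 \<le> L" "\<And>\<xi>. \<xi> \<in> carrier_vec N \<Longrightarrow> l1_norm (\<xi> :: complex vec) \<le> L * l2_norm \<xi>"
  shows "linf_norm (grad_Fsom D \<alpha>' m') \<le> max (\<gamma> * L) \<beta>"
  unfolding grad_Fsom_def
proof (rule linf_norm_stack_le)
  have \<alpha>': "\<And>j. j < incidences D \<Longrightarrow> \<alpha>' j \<in> carrier_vec N" and m': "m' \<in> carrier_vec M"
    using lim unfolding iterates_tendsto_iff vec_tendsto_def by auto
  have grad_m: "grad_m D \<alpha>' m' = grad_contrast \<alpha>' m'" by (intro grad_m_eq \<alpha>' m')
  show "linf_norm (grad_m D \<alpha>' m') \<le> max (\<gamma> * L) \<beta>"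
    unfolding grad_m linf_norm_le_iff
    using limit_grad_contrast_le[OF lim] carrier_vecD[OF grad_contrast_carrier] \<beta>_pos
    by (auto intro: le_max_iff_disj[THEN iffD2])
  fix j assume j: "j < incidences D"
  \<comment> \<open>The \<alpha> part is controlled in the Euclidean norm, which dominates each
    entry.\<close>
  have "cmod (grad_single j (\<alpha>' j) m' $ i) \<le> \<gamma> * L" if "i < N" for i
    using norm_le_l2_norm[of i "grad_single j (\<alpha>' j) m'"] carrier_vecD[OF grad_single_carrier] that
      limit_grad_single_le[OF j lim L] by fastforce
  then show "linf_norm (grad_alpha D \<alpha>' m' j) \<le> max (\<gamma> * L) \<beta>"
    unfolding grad_alpha_eq[where \<alpha> = \<alpha>', OF j \<alpha>'[OF j] m'] linf_norm_le_iff
    using carrier_vecD[OF grad_single_carrier] \<beta>_pos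
    by (auto intro: le_max_iff_disj[THEN iffD2])
qed

end

theorem corollary5p6:
  fixes n N M Q J L0 L\<alpha> :: nat
    and \<kappa> h \<gamma> \<beta> :: real
    and p :: "nat \<Rightarrow> int vec"
    and xhat d :: "nat \<Rightarrow> real vec"
    and uinf u v :: "nat \<Rightarrow> complex vec"
    and \<sigma> \<eta>s \<eta>d :: "nat \<Rightarrow> real"
    and m0 :: "complex vec"
    and D :: som_data
  assumes "n \<in> {2, 3}" and "0 < \<kappa>" and "0 < h" and "0 < N" and "M = N ^ n"
    and "bij_betw p {..<M} (grid n N)"
    and "0 < Q" and "distinct_directions n Q xhat"
    and "0 < J" and "distinct_directions n J d"
    and "\<forall>j<J. uinf j \<in> carrier_vec Q"
    and "is_svd (far_field_matrix n M Q \<kappa> h xhat p) u \<sigma> v L0"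
    and "1 \<le> L\<alpha>" and "L\<alpha> \<le> L0"
    and "\<forall>j<J. 0 < \<eta>s j \<and> 0 < \<eta>d j"
    and "m0 \<in> carrier_vec M"
    and "0 < \<gamma>" and "0 < \<beta>"
    and "D = \<lparr>incidences = J,
              Tvol = volume_matrix n M \<kappa> h p,
              Tinf = far_field_matrix n M Q \<kappa> h xhat p,
              Vn = noise_matrix M L\<alpha> v,
              omega_s = (\<lambda>j. signal_part M L\<alpha> u \<sigma> v (uinf j)),
              u_inc = (\<lambda>j. incident_field M \<kappa> h p (d j)),
              u_inf = uinf,
              eta_s = \<eta>s,
              eta_d = \<eta>d\<rparr>"
  shows "(\<exists>\<alpha>' m'. iterates_tendsto D (irsom D \<gamma> \<beta> m0) \<alpha>' m') \<and>
         (\<forall>L \<epsilon> \<alpha>' m'.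
            sqrt (real (M - L\<alpha>)) \<le> L \<longrightarrow>
            (\<forall>\<xi> \<in> carrier_vec (M - L\<alpha>). l1_norm (\<xi> :: complex vec) \<le> L * l2_norm \<xi>) \<longrightarrow>
            \<epsilon> = max (\<gamma> * L) \<beta> \<longrightarrow>
            iterates_tendsto D (irsom D \<gamma> \<beta> m0) \<alpha>' m' \<longrightarrow>
            linf_norm (grad_Fsom D \<alpha>' m') \<le> \<epsilon>)"
proof -
  \<comment> \<open>The noise matrix has the columns \<open>v L\<alpha>, ..., v (M - 1)\<close>,
    whence the block dimension \<open>M - L\<alpha>\<close>.\<close>
  interpret som_iteration D M "M - L\<alpha>" Q \<gamma> \<beta> m0
  proof
    show "Vn D \<in> carrier_mat M (M - L\<alpha>)"
      using mat_of_cols_carrier(1)[of M "map v [L\<alpha>..<M]"] by (simp add: assms noise_matrix_def)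
  qed (use assms(11,15-18) in \<open>simp_all add: assms(19) volume_matrix_def far_field_matrix_def
      signal_part_def incident_field_def\<close>)
  show ?thesis
  proof (intro conjI allI impI ex_iterates_tendsto)
    fix L \<epsilon> \<alpha>' m'
    assume L: "sqrt (real (M - L\<alpha>)) \<le> L"
      "\<forall>\<xi> \<in> carrier_vec (M - L\<alpha>). l1_norm (\<xi> :: complex vec) \<le> L * l2_norm \<xi>"
      and "\<epsilon> = max (\<gamma> * L) \<beta>" and "iterates_tendsto D (irsom D \<gamma> \<beta> m0) \<alpha>' m'"
    moreover have "0 \<le> L" using L(1) real_sqrt_ge_zero[of "real (M - L\<alpha>)"] by linarith
    ultimately show "linf_norm (grad_Fsom D \<alpha>' m') \<le> \<epsilon>"
      using limit_stationary by blast
  qed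
qed

end
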